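(* (i) A crystal has no nowhere-zero $3$-flow if and only if each of its vertices has odd degree. (ii) A crystal is $\mathbb{Z}_3$-connected if and only if it is vertex-$3$-colorable.
   Context: Graphs are finite, may contain parallel edges, but have no loops. Triangle-tree: a graph formed by starting with a triangle $x_1x_2x_3$ and then repeatedly (zero or more times) adding a new vertex $x_{j+1}$ joined to exactly two vertices $y,z$ that are adjacent in the graph already constructed (so $x_{j+1},y,z$ form a triangle). A leaf of a triangle-tree is a vertex of degree $2$ in it. For $n\ge 4$ vertices, a triangle-path is a triangle-tree with precisely two leaves; a single triangle ($n=3$) is also considered a trivial triangle-path. Crystal: a graph consisting of a triangle-path plus an extra edge connecting two leaves of the triangle-path. Nowhere-zero $3$-flow: a pair $(D,f)$ where $D$ is an orientation of $G$ and $f:E(G)\to\{\pm1,\pm2\}$ satisfies $\sum_{e\in E_D^+(v)}f(e)=\sum_{e\in E_D^-(v)}f(e)$ for every vertex $v$, where $E_D^+(v)$, $E_D^-(v)$ are the sets of arcs leaving and entering $v$. $\mathbb{Z}_3$-connected: a $\mathbb{Z}_3$-boundary of $G$ is a map $\beta:V(G)\to\mathbb{Z}_3$ with $\sum_{v\in V(G)}\beta(v)\equiv 0\pmod 3$. $G$ is $\mathbb{Z}_3$-connected if for every $\mathbb{Z}_3$-boundary $\beta$ there is an orientation $D$ of $G$ with $d_D^+(v)-d_D^-(v)\equiv\beta(v)\pmod 3$ for every vertex $v$ (out-degree minus in-degree). *)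

theory Defs
  imports "Graph_Theory.Digraph" "HOL-Number_Theory.Cong"
begin

text \<open>
  Undirected multigraphs. As in \<^typ>\<open>('v, 'e) pre_digraph\<close>, edges have an identity of their own
  (so parallel edges are possible), and the values of the endpoint map outside the edge set are
  irrelevant.
\<close>

record ('v, 'e) mgraph =
  mverts :: "'v set"
  medges :: "'e set"
  mends :: "'e \<Rightarrow> 'v set"

locale loopfree_mgraph =
  fixes G :: "('v, 'e) mgraph"
  assumes finite_mverts: "finite (mverts G)"
    and finite_medges: "finite (medges G)"
    and mends_in_mverts: "e \<in> medges G \<Longrightarrow> mends G e \<subseteq> mverts G"
    and no_loops: "e \<in> medges G \<Longrightarrow> card (mends G e) = 2"

definition madjacent :: "('v, 'e) mgraph \<Rightarrow> 'v \<Rightarrow> 'v \<Rightarrow> bool" where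
  "madjacent G u v \<longleftrightarrow> (\<exists>e \<in> medges G. mends G e = {u, v})"

definition vertex_degree :: "('v, 'e) mgraph \<Rightarrow> 'v \<Rightarrow> nat" where
  "vertex_degree G v = card {e \<in> medges G. v \<in> mends G e}"

text \<open>
  Since the endpoint map is total, it can be kept fixed during the construction: it already
  prescribes the endpoints of the edges added later.
\<close>

inductive triangle_tree :: "('v, 'e) mgraph \<Rightarrow> bool" where
  triangle:
    "\<lbrakk>distinct [x, y, z]; distinct [a, b, c]; \<phi> a = {y, z}; \<phi> b = {x, z}; \<phi> c = {x, y}\<rbrakk> \<Longrightarrow>
      triangle_tree \<lparr>mverts = {x, y, z}, medges = {a, b, c}, mends = \<phi>\<rparr>"
| add_vertex:
    "\<lbrakk>triangle_tree T; x \<notin> mverts T; madjacent T y z;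
      a \<notin> medges T; b \<notin> medges T; a \<noteq> b; mends T a = {x, y}; mends T b = {x, z}\<rbrakk> \<Longrightarrow>
      triangle_tree (T\<lparr>mverts := insert x (mverts T), medges := insert a (insert b (medges T))\<rparr>)"

definition tree_leaf :: "('v, 'e) mgraph \<Rightarrow> 'v \<Rightarrow> bool" where
  "tree_leaf T v \<longleftrightarrow> v \<in> mverts T \<and> vertex_degree T v = 2"

definition triangle_path :: "('v, 'e) mgraph \<Rightarrow> bool" where
  "triangle_path T \<longleftrightarrow> triangle_tree T \<and>
    (card (mverts T) = 3 \<or> card (mverts T) \<ge> 4 \<and> card {v. tree_leaf T v} = 2)"

text \<open>
  In a single triangle all three vertices are leaves, so a triangle with one edge doubled is a
  crystal.
\<close>

definition crystal :: "('v, 'e) mgraph \<Rightarrow> bool" where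
  "crystal G \<longleftrightarrow> (\<exists>T e u w. triangle_path T \<and> tree_leaf T u \<and> tree_leaf T w \<and> u \<noteq> w \<and>
    e \<notin> medges T \<and> mends T e = {u, w} \<and> G = T\<lparr>medges := insert e (medges T)\<rparr>)"

definition orientation :: "('v, 'e) mgraph \<Rightarrow> ('v, 'e) pre_digraph \<Rightarrow> bool" where
  "orientation G D \<longleftrightarrow> verts D = mverts G \<and> arcs D = medges G \<and>
    (\<forall>e \<in> medges G. {tail D e, head D e} = mends G e)"

definition nowhere_zero_3_flow ::
  "('v, 'e) mgraph \<Rightarrow> ('v, 'e) pre_digraph \<Rightarrow> ('e \<Rightarrow> int) \<Rightarrow> bool" where
  "nowhere_zero_3_flow G D f \<longleftrightarrow> orientation G D \<and>
    (\<forall>e \<in> medges G. f e \<in> {1, - 1, 2, - 2}) \<and>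
    (\<forall>v \<in> mverts G. (\<Sum>e \<in> out_arcs D v. f e) = (\<Sum>e \<in> in_arcs D v. f e))"

text \<open>Residues modulo 3 are represented by arbitrary integers, compared up to congruence.\<close>

definition Z3_boundary :: "('v, 'e) mgraph \<Rightarrow> ('v \<Rightarrow> int) \<Rightarrow> bool" where
  "Z3_boundary G \<beta> \<longleftrightarrow> [(\<Sum>v \<in> mverts G. \<beta> v) = 0] (mod 3)"

definition Z3_connected :: "('v, 'e) mgraph \<Rightarrow> bool" where
  "Z3_connected G \<longleftrightarrow> (\<forall>\<beta>. Z3_boundary G \<beta> \<longrightarrow>
    (\<exists>D. orientation G D \<and>
      (\<forall>v \<in> mverts G. [int (out_degree D v) - int (in_degree D v) = \<beta> v] (mod 3))))"

definition vertex_colorable :: "nat \<Rightarrow> ('v, 'e) mgraph \<Rightarrow> bool" where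
  "vertex_colorable k G \<longleftrightarrow> (\<exists>c :: 'v \<Rightarrow> nat. (\<forall>v \<in> mverts G. c v < k) \<and>
    (\<forall>u \<in> mverts G. \<forall>v \<in> mverts G. madjacent G u v \<longrightarrow> c u \<noteq> c v))"

text \<open>Crystals are finite and loopless by construction.\<close>

lemma triangle_tree_loopfree: "triangle_tree T \<Longrightarrow> loopfree_mgraph T"
proof (induction rule: triangle_tree.induct)
  case (triangle x y z a b c \<phi>)
  then show ?case by unfold_locales auto
next
  case (add_vertex T x y z a b)
  interpret loopfree_mgraph T by fact
  from add_vertex.hyps obtain g where g: "g \<in> medges T" "mends T g = {y, z}"
    by (auto simp: madjacent_def)
  then have "y \<in> mverts T" "z \<in> mverts T" using mends_in_mverts[of g] by auto
  then show ?case
    using add_vertex.hyps finite_mverts finite_medges mends_in_mverts no_loops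
    by unfold_locales (auto simp: card_insert_if)
qed

lemma crystal_loopfree:
  assumes "crystal G"
  shows "loopfree_mgraph G"
proof -
  from assms obtain T e u w where T: "triangle_tree T" "u \<in> mverts T" "w \<in> mverts T" "u \<noteq> w"
      "mends T e = {u, w}" "G = T\<lparr>medges := insert e (medges T)\<rparr>"
    by (auto simp: crystal_def triangle_path_def tree_leaf_def)
  interpret loopfree_mgraph T by (rule triangle_tree_loopfree) fact
  show ?thesis
    using T finite_mverts finite_medges mends_in_mverts no_loops
    by unfold_locales auto
qed

end

theory Submission
  imports Defs
begin

text \<open>
  For a triangle-tree with set of triangles \<open>\<T>\<close>, the \<open>\<int>\<^sub>3\<close>-boundaries that no orientation realizes
  turn out to be exactly the combinations \<open>\<Sum>\<^bsub>t\<in>\<T>\<^esub> s\<^sub>t 1\<^sub>t\<close> of indicators of triangles with signs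
  \<open>s\<^sub>t = \<plusminus>1\<close>. This is an induction on the construction; the point is that \<open>1\<^sub>y - 1\<^sub>z\<close> lies in the span
  of the indicators iff \<open>y\<close> and \<open>z\<close> get the same colour in the essentially unique 3-colouring,
  because the span is the orthogonal complement of the constants and the colouring.
  After adding the edge \<open>uw\<close>, a boundary \<open>\<beta>\<close> is missed iff both \<open>\<beta> \<plusminus> (1\<^sub>u - 1\<^sub>w)\<close> are such
  combinations. Some \<open>\<beta>\<close> has this property iff \<open>1\<^sub>u - 1\<^sub>w\<close> is in the span, which gives (ii).
  The boundary \<open>0\<close> has it iff \<open>1\<^sub>u - 1\<^sub>w\<close> is itself a signed sum. Along a triangle-path the signs are
  then forced to alternate, so the sum at an inner vertex vanishes iff it lies in an even
  number of triangles, which is one less than its degree; this gives (i).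
  Orientations that are balanced modulo 3 and nowhere-zero 3-flows are exchanged by subtracting 3
  on a set of arcs provided by a Hoffman-type theorem.
\<close>

subsection \<open>Orientations modulo 3 and flows\<close>

text \<open>Gale-Hoffman feasibility with unit capacities. Induction on the arcs: the next arc is
  either left out (demand \<open>b\<close>) or used (demand \<open>b'\<close>). If both choices
  violate the cut condition, on sets \<open>X\<close> and \<open>Y\<close>, submodularity of the
  out-degree \<open>d\<close> gives a contradiction.\<close>

lemma arc_subset_with_boundary:
  fixes tl hd :: "'e \<Rightarrow> 'v" and b :: "'v \<Rightarrow> int"
  assumes "finite E" "finite V" "\<And>e. e \<in> E \<Longrightarrow> tl e \<in> V \<and> hd e \<in> V" "sum b V = 0"
    "\<And>X. X \<subseteq> V \<Longrightarrow> sum b X \<le> (\<Sum>e\<in>E. of_bool (tl e \<in> X \<and> hd e \<notin> X))"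
  shows "\<exists>F\<subseteq>E. \<forall>v\<in>V. b v = (\<Sum>e\<in>F. of_bool (tl e = v) - of_bool (hd e = v))"
  using assms
proof (induction E arbitrary: b rule: finite_induct)
  case empty
  have "b v \<le> 0" if "v \<in> V" for v
    using empty.prems(4)[of "{v}"] that by simp
  then have "\<forall>v\<in>V. b v = 0"
    using empty.prems(1,3) sum_nonneg_eq_0_iff[of V "\<lambda>v. - b v"] by (simp add: sum_negf)
  then show ?case by simp
next
  case (insert e E)
  define d where "d X = (\<Sum>e\<in>E. of_bool (tl e \<in> X \<and> hd e \<notin> X) :: int)" for X
  define b' where "b' v = b v - of_bool (v = tl e) + of_bool (v = hd e)" for v
  have ends: "tl e \<in> V" "hd e \<in> V" using insert.prems by auto
  have cut: "sum b X \<le> of_bool (tl e \<in> X \<and> hd e \<notin> X) + d X" if "X \<subseteq> V" for X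
    using insert.prems(4)[OF that] unfolding d_def sum.insert[OF insert.hyps] .
  have sum_b': "sum b' X = sum b X - of_bool (tl e \<in> X) + of_bool (hd e \<in> X)" if "X \<subseteq> V" for X
    using finite_subset[OF that \<open>finite V\<close>]
    by (simp add: b'_def sum.distrib sum_subtractf of_bool_def)
  consider "\<forall>X\<subseteq>V. sum b X \<le> d X" | "\<forall>X\<subseteq>V. sum b' X \<le> d X"
    | X Y where "X \<subseteq> V" "sum b X > d X" "Y \<subseteq> V" "sum b' Y > d Y"
    by (meson not_le)
  then show ?case
  proof cases
    case 1
    then obtain F where "F \<subseteq> E" "\<forall>v\<in>V. b v = (\<Sum>e\<in>F. of_bool (tl e = v) - of_bool (hd e = v))"
      using insert.IH[of b] insert.prems by (auto simp: d_def)
    then show ?thesis by blast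
  next
    case 2
    have "sum b' V = 0" using sum_b'[of V] insert.prems ends by simp
    then obtain F where F: "F \<subseteq> E"
        "\<forall>v\<in>V. b' v = (\<Sum>e\<in>F. of_bool (tl e = v) - of_bool (hd e = v))"
      using insert.IH[of b'] insert.prems 2 by (auto simp: d_def)
    moreover have "finite F" "e \<notin> F" using F insert.hyps finite_subset by auto
    ultimately show ?thesis
      by (intro exI[of _ "insert e F"]) (auto simp: b'_def eq_commute algebra_simps)
  next
    case 3
    have fin: "finite X" "finite Y" using 3 \<open>finite V\<close> finite_subset by auto
    have X: "tl e \<in> X" "hd e \<notin> X" "sum b X \<ge> d X + 1"
      using cut[of X] 3 by (auto simp: of_bool_def split: if_splits)
    have Y: "tl e \<notin> Y" "hd e \<in> Y" "sum b Y \<ge> d Y"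
      using cut[of Y] 3 sum_b'[of Y] by (auto simp: of_bool_def split: if_splits)
    have "d (X \<inter> Y) + d (X \<union> Y) \<le> d X + d Y"
      unfolding d_def sum.distrib[symmetric] by (intro sum_mono) auto
    \<comment> \<open>The arc leaves \<open>X\<close> and enters \<open>Y\<close>, so it leaves
      neither the intersection nor the union; there the cut condition holds without it.\<close>
    moreover have "sum b (X \<inter> Y) \<le> d (X \<inter> Y)" "sum b (X \<union> Y) \<le> d (X \<union> Y)"
      using cut[of "X \<inter> Y"] cut[of "X \<union> Y"] X Y 3 by auto
    moreover have "sum b (X \<union> Y) + sum b (X \<inter> Y) = sum b X + sum b Y"
      using fin by (rule sum.union_inter)
    ultimately show ?thesis using X Y by linarith
  qed
qed

section \<open>Boundaries attained by some orientation\<close>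

text \<open>An orientation is reduced to a tail map and a head map, and the net out-degree to one
  sum over edges, so that edges can be split off one at a time.\<close>

definition attains :: "('v, 'e) mgraph \<Rightarrow> ('v \<Rightarrow> int) \<Rightarrow> bool" where
  "attains G \<beta> \<longleftrightarrow> (\<exists>tl hd. (\<forall>e\<in>medges G. {tl e, hd e} = mends G e) \<and>
    (\<forall>v\<in>mverts G. [(\<Sum>e\<in>medges G. of_bool (tl e = v) - of_bool (hd e = v)) = \<beta> v] (mod 3)))"

lemma out_minus_in:
  fixes f :: "'e \<Rightarrow> int"
  assumes "finite (arcs D)"
  shows "sum f (out_arcs D v) - sum f (in_arcs D v) =
    (\<Sum>e\<in>arcs D. f e * (of_bool (tail D e = v) - of_bool (head D e = v)))"
proof -
  have "sum f (out_arcs D v) = (\<Sum>e\<in>arcs D. f e * of_bool (tail D e = v))"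
    unfolding out_arcs_def using assms by (intro sum.mono_neutral_cong_left) auto
  moreover have "sum f (in_arcs D v) = (\<Sum>e\<in>arcs D. f e * of_bool (head D e = v))"
    unfolding in_arcs_def using assms by (intro sum.mono_neutral_cong_left) auto
  ultimately show ?thesis by (simp add: right_diff_distrib sum_subtractf)
qed

lemma out_degree_minus_in_degree:
  assumes "finite (arcs D)"
  shows "int (out_degree D v) - int (in_degree D v) =
    (\<Sum>e\<in>arcs D. of_bool (tail D e = v) - of_bool (head D e = v))"
  using out_minus_in[OF assms, of "\<lambda>_. 1" v] by (simp add: out_degree_def in_degree_def)

lemma Z3_connected_iff_attains:
  assumes "finite (medges G)"
  shows "Z3_connected G \<longleftrightarrow> (\<forall>\<beta>. Z3_boundary G \<beta> \<longrightarrow> attains G \<beta>)"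
proof -
  have "(\<exists>D. orientation G D \<and>
      (\<forall>v \<in> mverts G. [int (out_degree D v) - int (in_degree D v) = \<beta> v] (mod 3)))
    \<longleftrightarrow> attains G \<beta>" (is "?L \<longleftrightarrow> ?R") for \<beta>
  proof
    assume ?L
    then obtain D where D: "orientation G D"
      "\<forall>v \<in> mverts G. [int (out_degree D v) - int (in_degree D v) = \<beta> v] (mod 3)" by blast
    then show ?R
      using out_degree_minus_in_degree[of D] assms
      unfolding attains_def orientation_def
      by (rule_tac exI[of _ "tail D"], rule_tac exI[of _ "head D"]) simp
  next
    assume ?R
    then obtain tl hd where *: "\<forall>e\<in>medges G. {tl e, hd e} = mends G e"
      "\<forall>v\<in>mverts G. [(\<Sum>e\<in>medges G. of_bool (tl e = v) - of_bool (hd e = v)) = \<beta> v] (mod 3)"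
      by (auto simp: attains_def)
    then show ?L
      using assms
      by (intro exI[of _ "\<lparr>verts = mverts G, arcs = medges G, tail = tl, head = hd\<rparr>"])
        (auto simp: orientation_def out_degree_minus_in_degree)
  qed
  then show ?thesis by (simp add: Z3_connected_def)
qed

text \<open>Modulo 3 every flow value is 1 or -1, and reversing the arcs with residue -1 leaves the
  constant 1. Conversely, the net out-degrees of a balanced orientation are multiples of 3; a set
  \<open>F\<close> of arcs carrying a third of each turns the constant 1 into a genuine flow with
  values 1 and -2.\<close>

lemma (in loopfree_mgraph) nowhere_zero_3_flow_iff_attains_0:
  "(\<exists>D f. nowhere_zero_3_flow G D f) \<longleftrightarrow> attains G (\<lambda>_. 0)"
proof
  assume "\<exists>D f. nowhere_zero_3_flow G D f"
  then obtain D f where D: "orientation G D" and f: "\<forall>e \<in> medges G. f e \<in> {1, - 1, 2, - 2 :: int}"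
    and bal: "\<forall>v \<in> mverts G. sum f (out_arcs D v) = sum f (in_arcs D v)"
    by (auto simp: nowhere_zero_3_flow_def)
  \<comment> \<open>Arcs to be reversed: those whose flow value is congruent to -1 modulo 3.\<close>
  define r where "r e \<longleftrightarrow> f e \<in> {- 1, 2}" for e
  define tl where "tl e = (if r e then head D e else tail D e)" for e
  define hd where "hd e = (if r e then tail D e else head D e)" for e
  have "[(\<Sum>e\<in>medges G. of_bool (tl e = v) - of_bool (hd e = v)) = (0::int)] (mod 3)"
    if "v \<in> mverts G" for v
  proof -
    have "[of_bool (tl e = v) - of_bool (hd e = v) =
        f e * (of_bool (tail D e = v) - of_bool (head D e = v))] (mod 3)" if "e \<in> medges G" for e
      using f that by (auto simp: tl_def hd_def r_def cong_def)
    then have "[(\<Sum>e\<in>medges G. of_bool (tl e = v) - of_bool (hd e = v)) =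
        (\<Sum>e\<in>medges G. f e * (of_bool (tail D e = v) - of_bool (head D e = v)))] (mod 3)"
      by (rule cong_sum)
    moreover have "(\<Sum>e\<in>medges G. f e * (of_bool (tail D e = v) - of_bool (head D e = v))) = 0"
      using out_minus_in[of D f v] D bal that finite_medges by (simp add: orientation_def)
    ultimately show ?thesis by simp
  qed
  moreover have "\<forall>e\<in>medges G. {tl e, hd e} = mends G e"
    using D by (auto simp: orientation_def tl_def hd_def)
  ultimately show "attains G (\<lambda>_. 0)" by (auto simp: attains_def)
next
  assume "attains G (\<lambda>_. 0)"
  then obtain tl hd where ends: "\<forall>e\<in>medges G. {tl e, hd e} = mends G e"
    and mod0: "\<forall>v\<in>mverts G. 3 dvd (\<Sum>e\<in>medges G. of_bool (tl e = v) - of_bool (hd e = v) :: int)"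
    by (auto simp: attains_def cong_0_iff)
  define n where "n v = (\<Sum>e\<in>medges G. of_bool (tl e = v) - of_bool (hd e = v) :: int)" for v
  have in_V: "tl e \<in> mverts G \<and> hd e \<in> mverts G" if "e \<in> medges G" for e
    using ends that mends_in_mverts[OF that] by auto
  have sum_n: "sum n X = (\<Sum>e\<in>medges G. of_bool (tl e \<in> X) - of_bool (hd e \<in> X))"
    if "X \<subseteq> mverts G" for X
    using finite_subset[OF that finite_mverts]
    by (simp add: n_def sum.swap[of _ _ X] sum_subtractf of_bool_def)
  have third: "3 * (\<Sum>v\<in>X. n v div 3) = sum n X" if "X \<subseteq> mverts G" for X
    using that mod0 unfolding sum_distrib_left by (intro sum.cong) (auto simp: n_def)
  have "sum n (mverts G) = 0" using sum_n[of "mverts G"] in_V by simp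
  then have "(\<Sum>v\<in>mverts G. n v div 3) = 0" using third[of "mverts G"] by simp
  \<comment> \<open>Three times the left side is the number of arcs leaving \<open>X\<close> minus
    the number entering it, hence at most the number leaving; as that number is nonnegative, it also
    bounds the third.\<close>
  moreover have "(\<Sum>v\<in>X. n v div 3) \<le> (\<Sum>e\<in>medges G. of_bool (tl e \<in> X \<and> hd e \<notin> X))"
    if "X \<subseteq> mverts G" for X
  proof -
    have "sum n X \<le> (\<Sum>e\<in>medges G. of_bool (tl e \<in> X \<and> hd e \<notin> X))"
      unfolding sum_n[OF that] by (intro sum_mono) auto
    moreover have "0 \<le> (\<Sum>e\<in>medges G. of_bool (tl e \<in> X \<and> hd e \<notin> X) :: int)"
      by (intro sum_nonneg) auto
    ultimately show ?thesis using third[OF that] by linarith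
  qed
  ultimately have "\<exists>F\<subseteq>medges G. \<forall>v\<in>mverts G.
      n v div 3 = (\<Sum>e\<in>F. of_bool (tl e = v) - of_bool (hd e = v))"
    by (intro arc_subset_with_boundary finite_mverts finite_medges in_V)
  then obtain F where F: "F \<subseteq> medges G"
    "\<forall>v\<in>mverts G. n v div 3 = (\<Sum>e\<in>F. of_bool (tl e = v) - of_bool (hd e = v))"
    by auto
  define D where "D = \<lparr>verts = mverts G, arcs = medges G, tail = tl, head = hd\<rparr>"
  \<comment> \<open>Value -2 on \<open>F\<close> and 1 elsewhere: the excess \<open>n v\<close> is
    reduced by three times its third.\<close>
  define f where "f e = (1 - 3 * of_bool (e \<in> F) :: int)" for e
  have "sum f (out_arcs D v) = sum f (in_arcs D v)" if "v \<in> mverts G" for v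
  proof -
    have "(\<Sum>e\<in>medges G. of_bool (e \<in> F) * (of_bool (tl e = v) - of_bool (hd e = v))) = n v div 3"
      unfolding F(2)[rule_format, OF that] using F(1) finite_medges
      by (intro sum.mono_neutral_cong_right) auto
    moreover have "3 * (n v div 3) = n v" using mod0 that by (simp add: n_def)
    ultimately have "(\<Sum>e\<in>medges G. f e * (of_bool (tl e = v) - of_bool (hd e = v))) = 0"
      by (simp add: f_def left_diff_distrib sum_subtractf n_def mult.assoc
          flip: sum_distrib_left)
    then show ?thesis using out_minus_in[of D f v] finite_medges by (simp add: D_def)
  qed
  then have "nowhere_zero_3_flow G D f"
    using ends by (auto simp: nowhere_zero_3_flow_def orientation_def D_def f_def)
  then show "\<exists>D f. nowhere_zero_3_flow G D f" by blast
qed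

section \<open>Adding an edge or an isolated vertex\<close>

lemma attains_cong:
  assumes "\<And>v. v \<in> mverts G \<Longrightarrow> [\<beta> v = \<gamma> v] (mod 3)"
  shows "attains G \<beta> \<longleftrightarrow> attains G \<gamma>"
  unfolding attains_def using assms by (meson cong_sym cong_trans)

text \<open>The alternatives are the two directions of the new edge, from \<open>w\<close> to
  \<open>u\<close> and from \<open>u\<close> to \<open>w\<close>; what the edge contributes is
  subtracted from \<open>\<beta>\<close>.\<close>

lemma attains_add_edge:
  assumes "finite (medges G)" "e \<notin> medges G" "mends G e = {u, w}"
  shows "attains (G\<lparr>medges := insert e (medges G)\<rparr>) \<beta> \<longleftrightarrow>
    attains G (\<lambda>v. \<beta> v + (of_bool (v = u) - of_bool (v = w))) \<or>
    attains G (\<lambda>v. \<beta> v - (of_bool (v = u) - of_bool (v = w)))" (is "?L \<longleftrightarrow> ?R1 \<or> ?R2")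
proof
  assume ?L
  then obtain tl hd where *: "\<forall>e\<in>medges G. {tl e, hd e} = mends G e" "{tl e, hd e} = {u, w}"
    "\<forall>v\<in>mverts G. [of_bool (tl e = v) - of_bool (hd e = v) +
      (\<Sum>e\<in>medges G. of_bool (tl e = v) - of_bool (hd e = v)) = \<beta> v] (mod 3)"
    using assms by (auto simp: attains_def)
  from *(2) consider "tl e = u" "hd e = w" | "tl e = w" "hd e = u"
    by (auto simp: doubleton_eq_iff)
  then show "?R1 \<or> ?R2"
  proof cases
    case 1
    have ?R2 unfolding attains_def
      using *(1,3) 1
      by (rule_tac exI[of _ tl], rule_tac exI[of _ hd]) (auto simp: cong_iff_dvd_diff algebra_simps eq_commute)
    then show ?thesis ..
  next
    case 2
    have ?R1 unfolding attains_def
      using *(1,3) 2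
      by (rule_tac exI[of _ tl], rule_tac exI[of _ hd]) (auto simp: cong_iff_dvd_diff algebra_simps eq_commute)
    then show ?thesis ..
  qed
next
  \<comment> \<open>\<open>p\<close> and \<open>q\<close> are the tail and head given to the new
    edge, so that both directions are covered at once.\<close>
  have key: ?L if "attains G (\<lambda>v. \<beta> v - (of_bool (v = p) - of_bool (v = q)))" "{p, q} = {u, w}" for p q
  proof -
    from that obtain tl hd where *: "\<forall>e\<in>medges G. {tl e, hd e} = mends G e"
      "\<forall>v\<in>mverts G. [(\<Sum>e\<in>medges G. of_bool (tl e = v) - of_bool (hd e = v)) =
        \<beta> v - (of_bool (v = p) - of_bool (v = q))] (mod 3)"
      by (auto simp: attains_def)
    have "(\<Sum>e'\<in>medges G. of_bool ((tl(e := p)) e' = v) - of_bool ((hd(e := q)) e' = v)) =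
      (\<Sum>e\<in>medges G. of_bool (tl e = v) - of_bool (hd e = v) :: int)" for v
      using assms(2) by (intro sum.cong) auto
    then show ?thesis
      unfolding attains_def using * assms that
      by (rule_tac exI[of _ "tl(e := p)"], rule_tac exI[of _ "hd(e := q)"])
        (auto simp: cong_iff_dvd_diff algebra_simps eq_commute)
  qed
  assume "?R1 \<or> ?R2"
  then show ?L using key[of u w] key[of w u] by (auto simp: algebra_simps insert_commute)
qed

text \<open>No edge meets \<open>x\<close>, so its net out-degree is 0. A triangle-tree then grows
  in three stages: the bare vertex, followed by its two edges.\<close>

lemma (in loopfree_mgraph) attains_add_vertex:
  assumes "x \<notin> mverts G"
  shows "attains (G\<lparr>mverts := insert x (mverts G)\<rparr>) \<beta> \<longleftrightarrow> [\<beta> x = 0] (mod 3) \<and> attains G \<beta>"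
proof -
  have "(\<Sum>e\<in>medges G. of_bool (tl e = x) - of_bool (hd e = x)) = (0::int)"
    if "\<forall>e\<in>medges G. {tl e, hd e} = mends G e" for tl hd
    using that mends_in_mverts assms by (intro sum.neutral) force
  then have "(\<forall>e\<in>medges G. {tl e, hd e} = mends G e) \<and>
      (\<forall>v\<in>insert x (mverts G).
        [(\<Sum>e\<in>medges G. of_bool (tl e = v) - of_bool (hd e = v)) = \<beta> v] (mod 3)) \<longleftrightarrow>
    [\<beta> x = 0] (mod 3) \<and> (\<forall>e\<in>medges G. {tl e, hd e} = mends G e) \<and>
      (\<forall>v\<in>mverts G.
        [(\<Sum>e\<in>medges G. of_bool (tl e = v) - of_bool (hd e = v)) = \<beta> v] (mod 3))" for tl hd
    by (cases "\<forall>e\<in>medges G. {tl e, hd e} = mends G e")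
      (simp add: cong_sym_eq[of 0 "\<beta> x"] del: sum_subtractf sum_of_bool_eq, blast)
  then show ?thesis by (simp add: attains_def)
qed

subsection \<open>Triangle stacks and strips\<close>

text \<open>With \<open>s\<close> constantly 1 and \<open>\<T>\<close> finite this counts the
  triangles at \<open>v\<close>.\<close>

definition tri_sum :: "('v set \<Rightarrow> int) \<Rightarrow> 'v set set \<Rightarrow> 'v \<Rightarrow> int" where
  "tri_sum s \<T> v = (\<Sum>t\<in>\<T>. s t * of_bool (v \<in> t))"

lemma tri_sum_insert:
  "finite \<T> \<Longrightarrow> t \<notin> \<T> \<Longrightarrow> tri_sum s (insert t \<T>) v = s t * of_bool (v \<in> t) + tri_sum s \<T> v"
  by (simp add: tri_sum_def)

lemma tri_sum_singleton: "tri_sum s {t} v = s t * of_bool (v \<in> t)"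
  by (simp add: tri_sum_def)

lemma tri_sum_fresh: "v \<notin> \<Union>\<T> \<Longrightarrow> tri_sum s \<T> v = 0"
  unfolding tri_sum_def by (intro sum.neutral) auto

lemma tri_sum_upd: "t \<notin> \<T> \<Longrightarrow> tri_sum (s(t := k)) \<T> = tri_sum s \<T>"
  unfolding tri_sum_def fun_eq_iff by (intro allI sum.cong) auto

lemma tri_sum_uminus: "tri_sum (\<lambda>t. - s t) \<T> v = - tri_sum s \<T> v"
  by (simp add: tri_sum_def sum_negf)

lemma tri_sum_diff: "tri_sum (\<lambda>t. s t - s' t) \<T> v = tri_sum s \<T> v - tri_sum s' \<T> v"
  unfolding tri_sum_def left_diff_distrib sum_subtractf ..

lemma tri_sum_cong_mod:
  "(\<And>t. [s t = s' t] (mod k)) \<Longrightarrow> [tri_sum s \<T> v = tri_sum s' \<T> v] (mod k)"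
  unfolding tri_sum_def by (intro cong_sum cong_mult cong_refl)

text \<open>Double counting. It is applied with \<open>c\<close> constantly 1 and with
  \<open>c\<close> a colouring; in both cases every triangle has sum 3.\<close>

lemma sum_tri_sum:
  assumes "finite V" "\<Union>\<T> \<subseteq> V"
  shows "(\<Sum>v\<in>V. c v * tri_sum s \<T> v) = (\<Sum>t\<in>\<T>. s t * sum c t)"
proof -
  have "(\<Sum>v\<in>V. c v * (s t * of_bool (v \<in> t))) = s t * sum c t" if "t \<in> \<T>" for t
  proof -
    have "V \<inter> t = t" using assms that by auto
    then show ?thesis
      using assms(1)
      by (simp add: ac_simps sum.If_cases of_bool_def if_distrib sum_distrib_left cong: if_cong)
  qed
  then show ?thesis
    unfolding tri_sum_def sum_distrib_left by (subst sum.swap) simp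
qed

definition signs :: "('v set \<Rightarrow> int) \<Rightarrow> bool" where
  "signs s \<longleftrightarrow> range s \<subseteq> {1, - 1}"

lemma signsD: "signs s \<Longrightarrow> s t = 1 \<or> s t = - 1"
  by (auto simp: signs_def)

lemma signs_upd: "signs s \<Longrightarrow> k \<in> {1, - 1} \<Longrightarrow> signs (s(t := k))"
  by (auto simp: signs_def)

text \<open>Signs are odd, so modulo 2 a signed sum merely counts triangles.\<close>

lemma tri_sum_parity:
  assumes "signs s"
  shows "odd (tri_sum s \<T> v) \<longleftrightarrow> odd (tri_sum (\<lambda>_. 1) \<T> v)"
proof -
  have "[s t = 1] (mod 2)" for t using signsD[OF assms, of t] by (auto simp: cong_def)
  then have "[tri_sum s \<T> v = tri_sum (\<lambda>_. 1) \<T> v] (mod 2)" by (rule tri_sum_cong_mod)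
  then show ?thesis by (simp add: cong_def odd_iff_mod_2_eq_one)
qed

section \<open>Triangle stacks and strips inside them\<close>

text \<open>Triangle-trees reduced to the vertex sets of their triangles; \<open>A\<close> is the
  edge to which the new triangle is glued.\<close>

inductive triangle_stack :: "'v set set \<Rightarrow> bool" where
  single: "card t = 3 \<Longrightarrow> triangle_stack {t}"
| push: "\<lbrakk>triangle_stack \<T>; t \<in> \<T>; A \<subseteq> t; card A = 2; x \<notin> \<Union>\<T>\<rbrakk> \<Longrightarrow> triangle_stack (insert (insert x A) \<T>)"

lemma triangle_stack_finite: "triangle_stack \<T> \<Longrightarrow> finite \<T> \<and> (\<forall>t\<in>\<T>. card t = 3)"
proof (induction rule: triangle_stack.induct)
  case (push \<T> t A x)
  then have "finite A" "x \<notin> A" by (auto intro: card_ge_0_finite)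
  with push show ?case by simp
qed simp

lemma tri_sum_pos: "finite \<T> \<Longrightarrow> v \<in> \<Union>\<T> \<Longrightarrow> tri_sum (\<lambda>_. 1) \<T> v \<ge> 1"
  by (auto simp: tri_sum_def of_bool_def sum.If_cases card_gt_0_iff Suc_le_eq)

text \<open>
  \<open>triangle_strip u A \<T>\<close>: the triangles \<open>\<T>\<close> form a path that starts at the leaf \<open>u\<close>, and the next
  triangle of the path may be glued to the edge \<open>A\<close>.
\<close>

inductive triangle_strip :: "'v \<Rightarrow> 'v set \<Rightarrow> 'v set set \<Rightarrow> bool" where
  start: "\<lbrakk>card A = 2; u \<notin> A\<rbrakk> \<Longrightarrow> triangle_strip u A {insert u A}"
| extend: "\<lbrakk>triangle_strip u A \<T>; x \<notin> \<Union>\<T>; r \<in> A\<rbrakk> \<Longrightarrow>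
    triangle_strip u {x, r} (insert (insert x A) \<T>)"

lemma triangle_strip_basic:
  "triangle_strip u A \<T> \<Longrightarrow> finite \<T> \<and> card A = 2 \<and> u \<notin> A \<and> A \<subseteq> \<Union>\<T> \<and> u \<in> \<Union>\<T>"
proof (induction rule: triangle_strip.induct)
  case (extend u A \<T> x r)
  then have "x \<noteq> r" by auto
  with extend show ?case by auto
qed auto

text \<open>The sign of the last triangle serves as \<open>\<sigma>\<close>. A vertex that leaves
  the active edge has reached its final value, which must vanish; hence the next sign is opposite,
  and all values stay between -1 and 1.\<close>

lemma triangle_strip_tri_sum:
  assumes "triangle_strip u A \<T>" "signs s"
    "\<And>v. v \<in> \<Union>\<T> \<Longrightarrow> v \<noteq> u \<Longrightarrow> v \<notin> A \<Longrightarrow> [tri_sum s \<T> v = 0] (mod 3)"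
  shows "\<exists>\<sigma>\<in>{1, - 1}. (\<forall>r\<in>A. tri_sum s \<T> r \<in> {0, \<sigma>}) \<and> (\<forall>v. tri_sum s \<T> v \<in> {- 1, 0, 1})"
  using assms
proof (induction rule: triangle_strip.induct)
  case (start A u)
  then show ?case
    using signsD[OF start.prems(1), of "insert u A"] by (auto simp: tri_sum_singleton)
next
  case (extend u A \<T> x r)
  note basic = triangle_strip_basic[OF extend.hyps(1)]
  define k where "k = s (insert x A)"
  have k: "k = 1 \<or> k = - 1" using signsD[OF extend.prems(1)] by (simp add: k_def)
  have "insert x A \<notin> \<T>" using extend.hyps(2) by auto
  then have ins: "tri_sum s (insert (insert x A) \<T>) v = k * of_bool (v \<in> insert x A) + tri_sum s \<T> v" for v
    using basic by (simp add: tri_sum_insert k_def)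
  have fresh: "tri_sum s \<T> x = 0" using extend.hyps(2) by (rule tri_sum_fresh)
  have "[tri_sum s \<T> v = 0] (mod 3)" if "v \<in> \<Union>\<T>" "v \<noteq> u" "v \<notin> A" for v
    using extend.prems(2)[of v] that extend.hyps ins[of v] by auto
  from extend.IH[OF extend.prems(1) this] obtain \<sigma> where \<sigma>: "\<sigma> = 1 \<or> \<sigma> = - 1"
    "\<forall>r\<in>A. tri_sum s \<T> r \<in> {0, \<sigma>}" "\<forall>v. tri_sum s \<T> v \<in> {- 1, 0, 1}" by auto
  obtain q where q: "A = {q, r}" "q \<noteq> r" using basic extend.hyps(3) by (auto simp: card_2_iff)
  \<comment> \<open>\<open>q\<close> is not on the new active edge, so the hypothesis applies to it.
    As its old value is 0 or \<open>\<sigma>\<close>, the new sign \<open>k\<close> must be opposite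
    to \<open>\<sigma>\<close>.\<close>
  have "[k + tri_sum s \<T> q = 0] (mod 3)"
    using extend.prems(2)[of q] q basic extend.hyps ins[of q] by auto
  then have "tri_sum s \<T> q = - k" "\<sigma> = - k"
    using \<sigma> k q by (auto simp: cong_def)
  have "\<forall>\<rho>\<in>{x, r}. tri_sum s (insert (insert x A) \<T>) \<rho> \<in> {0, k}"
    using \<sigma>(2) \<open>\<sigma> = - k\<close> extend.hyps(3) fresh by (auto simp: ins)
  moreover have "tri_sum s (insert (insert x A) \<T>) v \<in> {- 1, 0, 1}" for v
  proof (cases "v \<in> insert x A")
    case True
    then show ?thesis
      using \<sigma>(2) \<open>\<sigma> = - k\<close> k fresh by (auto simp: ins)
  next
    case False
    then show ?thesis using \<sigma>(3) by (simp add: ins)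
  qed
  ultimately show ?case using k by blast
qed

text \<open>Each new sign is chosen as \<open>- \<sigma>\<close>, so the invariant of
  \<open>triangle_strip_tri_sum\<close> holds by construction.\<close>

lemma triangle_strip_signs:
  assumes "triangle_strip u A \<T>"
  shows "\<exists>s. signs s \<and> (\<exists>\<sigma>\<in>{1, - 1}. (\<forall>r\<in>A. tri_sum s \<T> r \<in> {0, \<sigma>}) \<and>
    (\<forall>v. tri_sum s \<T> v \<in> {- 1, 0, 1}))"
  using assms
proof (induction rule: triangle_strip.induct)
  case (start A u)
  then show ?case
    by (intro exI[of _ "\<lambda>_. 1"]) (auto simp: tri_sum_singleton signs_def)
next
  case (extend u A \<T> x r)
  note basic = triangle_strip_basic[OF extend.hyps(1)]
  from extend.IH obtain s \<sigma> where s: "signs s" and \<sigma>: "\<sigma> = 1 \<or> \<sigma> = - 1"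
    "\<forall>r\<in>A. tri_sum s \<T> r \<in> {0, \<sigma>}" "\<forall>v. tri_sum s \<T> v \<in> {- 1, 0, 1}" by auto
  have new: "insert x A \<notin> \<T>" using extend.hyps(2) by auto
  have ins: "tri_sum (s(insert x A := - \<sigma>)) (insert (insert x A) \<T>) v =
    - \<sigma> * of_bool (v \<in> insert x A) + tri_sum s \<T> v" for v
    using basic new by (simp add: tri_sum_insert tri_sum_upd)
  have fresh: "tri_sum s \<T> x = 0" using extend.hyps(2) by (rule tri_sum_fresh)
  have "signs (s(insert x A := - \<sigma>))" using s \<sigma> by (auto intro: signs_upd)
  moreover have "\<forall>\<rho>\<in>{x, r}. tri_sum (s(insert x A := - \<sigma>)) (insert (insert x A) \<T>) \<rho> \<in> {0, - \<sigma>}"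
    using \<sigma>(2) extend.hyps(3) fresh by (auto simp: ins)
  moreover have "tri_sum (s(insert x A := - \<sigma>)) (insert (insert x A) \<T>) v \<in> {- 1, 0, 1}" for v
  proof (cases "v \<in> insert x A")
    case True
    then show ?thesis using \<sigma>(1,2) fresh by (auto simp: ins)
  next
    case False
    then show ?thesis using \<sigma>(3) by (simp add: ins)
  qed
  moreover have "- \<sigma> \<in> {1, - 1}" using \<sigma>(1) by auto
  ultimately show ?case by blast
qed

text \<open>In a strip of several triangles, a vertex of the active edge lying in only one triangle
  is the vertex added last. The choice of \<open>r\<close> at that moment was free, so the active
  edge can be turned around this vertex to the edge at which a stack is continued.\<close>

lemma triangle_strip_active_edge:
  assumes "triangle_strip u A \<T>" "y \<in> A" "tri_sum (\<lambda>_. 1) \<T> y = 1"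
    "t \<in> \<T>" "y \<in> t" "z \<in> t" "z \<noteq> y" "z \<noteq> u"
  shows "triangle_strip u {y, z} \<T>"
  using assms(1)
proof cases
  case start
  then have "A = {y, z}" using assms by (auto simp: card_2_iff)
  then show ?thesis using assms(1) by simp
next
  case (extend A' \<T>' x r)
  note basic = triangle_strip_basic[OF extend(3)]
  have "insert x A' \<notin> \<T>'" using extend by auto
  then have sum: "tri_sum (\<lambda>_. 1) \<T> y = 1 * of_bool (y \<in> insert x A') + tri_sum (\<lambda>_. 1) \<T>' y"
    unfolding extend(2) using basic by (intro tri_sum_insert) auto
  have "\<not> (y \<in> \<Union>\<T>' \<and> y \<in> insert x A')"
  proof
    assume y: "y \<in> \<Union>\<T>' \<and> y \<in> insert x A'"
    then have "of_bool (y \<in> insert x A') = (1 :: int)" by (simp del: Union_iff)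
    moreover have "tri_sum (\<lambda>_. 1) \<T>' y \<ge> 1" using basic y by (intro tri_sum_pos) auto
    ultimately show False using sum assms(3) by linarith
  qed
  then have "y = x" using extend basic assms(2) by auto
  moreover have "z \<in> A'" using assms extend \<open>y = x\<close> by auto
  ultimately show ?thesis using triangle_strip.extend[OF extend(3,4)] extend by auto
qed

text \<open>Strips grow at their active end only. Gluing a triangle to the starting leaf needs an
  induction of its own, whose base rebuilds the strip of two triangles from the new start.\<close>

lemma triangle_strip_prepend:
  assumes "triangle_strip y A \<T>" "x \<notin> \<Union>\<T>" "t \<in> \<T>" "y \<in> t" "z \<in> t" "z \<noteq> y"
  shows "triangle_strip x A (insert {x, y, z} \<T>)"
  using assms
proof (induction rule: triangle_strip.induct)
  case (start A u)
  then obtain q where q: "A = {z, q}" "q \<noteq> z" by (auto simp: card_2_iff)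
  have "triangle_strip x {u, z} {insert x {u, z}}"
    using start by (intro triangle_strip.start) auto
  from triangle_strip.extend[OF this, of q z]
  have "triangle_strip x A (insert {q, u, z} {{x, u, z}})"
    using start q by (auto simp: insert_commute)
  then show ?case using q by (simp add: insert_commute)
next
  case (extend u A \<T> x' r)
  note basic = triangle_strip_basic[OF extend.hyps(1)]
  have "t \<in> \<T>" using extend.prems extend.hyps basic by auto
  then have "triangle_strip x A (insert {x, u, z} \<T>)" using extend by auto
  moreover have "x' \<notin> \<Union>(insert {x, u, z} \<T>)" using \<open>t \<in> \<T>\<close> extend by auto
  ultimately have "triangle_strip x {x', r} (insert (insert x' A) (insert {x, u, z} \<T>))"
    using extend.hyps by (intro triangle_strip.extend)
  then show ?case by (simp add: insert_commute)
qed

section \<open>Leaves, and stacks with two leaves as strips\<close>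

text \<open>By the degree formula in \<open>triangulates\<close>, lying in exactly one triangle
  means having degree 2.\<close>

definition leaves :: "'v set set \<Rightarrow> 'v set" where
  "leaves \<T> = {v \<in> \<Union>\<T>. tri_sum (\<lambda>_. 1) \<T> v = 1}"

text \<open>In particular three vertices mean a single triangle, which is how the trivial
  triangle-path is recognized.\<close>

lemma triangle_stack_Union:
  assumes "triangle_stack \<T>"
  shows "finite (\<Union>\<T>)" "card (\<Union>\<T>) = card \<T> + 2"
proof -
  have "finite (\<Union>\<T>) \<and> card (\<Union>\<T>) = card \<T> + 2"
    using assms
  proof (induction rule: triangle_stack.induct)
    case (push \<T> t A x)
    then have "insert x A \<notin> \<T>" "\<Union>(insert (insert x A) \<T>) = insert x (\<Union>\<T>)" by auto
    then show ?case using push triangle_stack_finite[OF push.hyps(1)] by simp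
  qed (auto intro: card_ge_0_finite)
  then show "finite (\<Union>\<T>)" "card (\<Union>\<T>) = card \<T> + 2" by auto
qed

lemma leaves_push:
  assumes "triangle_stack \<T>" "t \<in> \<T>" "A \<subseteq> t" "card A = 2" "x \<notin> \<Union>\<T>"
  shows "leaves (insert (insert x A) \<T>) = insert x (leaves \<T> - A)"
proof -
  have fin: "finite \<T>" using triangle_stack_finite assms by auto
  have "insert x A \<notin> \<T>" using assms by auto
  then have ins: "tri_sum (\<lambda>_. 1) (insert (insert x A) \<T>) v =
      of_bool (v \<in> insert x A) + tri_sum (\<lambda>_. 1) \<T> v" for v
    using fin by (simp add: tri_sum_insert)
  have "tri_sum (\<lambda>_. 1) \<T> x = 0" using assms by (intro tri_sum_fresh)
  moreover have "tri_sum (\<lambda>_. 1) \<T> v \<ge> 1" if "v \<in> A" for v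
    using fin assms that by (intro tri_sum_pos) auto
  ultimately show ?thesis using assms by (force simp: leaves_def ins)
qed

lemma leaves_single: "leaves {t} = t"
  by (auto simp: leaves_def tri_sum_singleton)

text \<open>A newly glued triangle has only its new vertex as a leaf. If the old stack is a lone
  triangle, two of its vertices cannot both avoid the glued edge; otherwise induction applies, since
  gluing makes no old vertex a leaf.\<close>

lemma leaves_nonadjacent:
  assumes "triangle_stack \<T>" "card \<T> \<noteq> 1" "t \<in> \<T>" "{y, z} \<subseteq> t" "y \<noteq> z"
  shows "\<not> {y, z} \<subseteq> leaves \<T>"
  using assms
proof (induction arbitrary: t rule: triangle_stack.induct)
  case (push \<T> t' A x t)
  have lv: "leaves (insert (insert x A) \<T>) = insert x (leaves \<T> - A)"
    using push.hyps by (rule leaves_push)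
  show ?case
  proof (cases "t = insert x A")
    case True
    then show ?thesis using push.prems lv by auto
  next
    case False
    then have t: "t \<in> \<T>" using push by auto
    then have x: "y \<noteq> x" "z \<noteq> x" using push by auto
    show ?thesis
    proof (cases "card \<T> = 1")
      case True
      then have "t = t'" using t push.hyps by (auto simp: card_1_singleton_iff)
      have "card t = 3" using triangle_stack_finite push.hyps(1) t by auto
      show ?thesis
      proof
        assume "{y, z} \<subseteq> leaves (insert (insert x A) \<T>)"
        then have "{y, z} \<inter> A = {}" using lv x by auto
        then have "card ({y, z} \<union> A) = 4"
          using push.hyps push.prems by (subst card_Un_disjoint) (auto intro: card_ge_0_finite)
        moreover have "card ({y, z} \<union> A) \<le> card t"
          using \<open>t = t'\<close> push.hyps push.prems \<open>card t = 3\<close>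
          by (intro card_mono) (auto intro: card_ge_0_finite)
        ultimately show False using \<open>card t = 3\<close> by simp
      qed
    next
      case False
      then show ?thesis using push.IH[OF False t] push.prems lv x by auto
    qed
  qed
qed simp

text \<open>Gluing adds one leaf and removes those in \<open>A\<close>. If \<open>A\<close>
  swallowed all leaves, they would be two adjacent leaves, so the stack would be a single triangle,
  which has three.\<close>

lemma card_leaves_ge_2: "triangle_stack \<T> \<Longrightarrow> card (leaves \<T>) \<ge> 2"
proof (induction rule: triangle_stack.induct)
  case (single t)
  then show ?case by (simp add: leaves_single)
next
  case (push \<T> t A x)
  have fin: "finite (leaves \<T>)"
    using push.IH by (intro card_ge_0_finite) simp
  have x: "x \<notin> leaves \<T>" using push.hyps by (auto simp: leaves_def)
  have "card (leaves \<T> - A) \<ge> 1"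
  proof (cases "leaves \<T> \<subseteq> A")
    case True
    then have eq: "leaves \<T> = A"
      using push by (intro card_seteq) (auto intro: card_ge_0_finite)
    obtain y z where yz: "A = {y, z}" "y \<noteq> z" using push.hyps by (auto simp: card_2_iff)
    then have "card \<T> = 1" using leaves_nonadjacent[of \<T> t y z] push.hyps eq by auto
    then have "leaves \<T> = t" using push.hyps by (auto simp: card_1_singleton_iff leaves_single)
    then show ?thesis using eq push.hyps triangle_stack_finite[of \<T>] by auto
  next
    case False
    then show ?thesis using fin by (simp add: Suc_le_eq card_gt_0_iff)
  qed
  then show ?case using fin x push.hyps by (simp add: leaves_push)
qed

text \<open>Besides the new leaf \<open>x\<close> only one old leaf \<open>r\<close> survives, while
  \<open>A\<close> contains an old leaf \<open>y\<close>. The strip from \<open>r\<close> to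
  \<open>y\<close> is extended by \<open>x\<close>; for the reverse direction, the strip from
  \<open>y\<close> to \<open>r\<close> is prolonged at its start.\<close>

lemma triangle_stack_imp_strip:
  assumes "triangle_stack \<T>" "card \<T> = 1 \<or> card (leaves \<T>) = 2"
    "u \<in> leaves \<T>" "w \<in> leaves \<T>" "u \<noteq> w"
  shows "\<exists>A. w \<in> A \<and> triangle_strip u A \<T>"
  using assms
proof (induction arbitrary: u w rule: triangle_stack.induct)
  case (single t)
  then have "card (t - {u}) = 2" by (simp add: leaves_single)
  from triangle_strip.start[OF this, of u] show ?case
    using single by (intro exI[of _ "t - {u}"]) (auto simp: leaves_single insert_absorb)
next
  case (push \<T> t A x)
  have fin: "finite (leaves \<T>)"
    using card_leaves_ge_2[OF push.hyps(1)] by (intro card_ge_0_finite) simp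
  have lv: "leaves (insert (insert x A) \<T>) = insert x (leaves \<T> - A)"
    using push.hyps by (intro leaves_push)
  have x: "x \<notin> leaves \<T>" "insert x A \<notin> \<T>" using push.hyps by (auto simp: leaves_def)
  have "card \<T> \<noteq> 0" using triangle_stack_finite[OF push.hyps(1)] push.hyps(2) by auto
  then have "card (insert (insert x A) \<T>) \<noteq> 1"
    using x triangle_stack_finite[OF push.hyps(1)] by simp
  then have card1: "card (leaves \<T> - A) = 1"
    using push.prems x fin by (simp add: lv)
  \<comment> \<open>Only one leaf survives outside \<open>A\<close>, so with three or more old
    leaves both ends of \<open>A\<close> would be leaves; adjacent leaves occur only in a single
    triangle.\<close>
  have base: "card \<T> = 1 \<or> card (leaves \<T>) = 2"
  proof (rule disjCI)
    assume "card (leaves \<T>) \<noteq> 2"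
    then have "card (leaves \<T>) \<ge> 3" using card_leaves_ge_2[OF push.hyps(1)] by simp
    moreover have "card (leaves \<T>) = card (leaves \<T> - A) + card (leaves \<T> \<inter> A)"
      using fin card_Int_Diff[of "leaves \<T>" A] by simp
    ultimately have "card (leaves \<T> \<inter> A) \<ge> card A" using card1 push.hyps by simp
    then have "leaves \<T> \<inter> A = A"
      using push.hyps by (intro card_seteq) (auto intro: card_ge_0_finite)
    moreover obtain y z where "A = {y, z}" "y \<noteq> z" using push.hyps by (auto simp: card_2_iff)
    ultimately show "card \<T> = 1" using leaves_nonadjacent[of \<T> t y z] push.hyps by auto
  qed
  obtain r where r: "leaves \<T> - A = {r}" using card1 by (auto simp: card_1_singleton_iff)
  have "leaves \<T> \<inter> A \<noteq> {}"
  proof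
    assume "leaves \<T> \<inter> A = {}"
    then have "leaves \<T> = {r}" using r by auto
    then show False using card_leaves_ge_2[OF push.hyps(1)] by simp
  qed
  then obtain y where y: "y \<in> leaves \<T>" "y \<in> A" by auto
  then obtain z where z: "A = {y, z}" "z \<noteq> y" using push.hyps by (auto simp: card_2_iff)
  have yr: "y \<noteq> r" "r \<in> leaves \<T>" using r y by auto
  have zr: "z \<noteq> r" using r z by auto
  have t: "t \<in> \<T>" "y \<in> t" "z \<in> t" using push.hyps z by auto
  have ends: "u = r \<and> w = x \<or> u = x \<and> w = r" using push.prems lv r by auto
  have "\<exists>A'. x \<in> A' \<and> triangle_strip r A' (insert (insert x A) \<T>)"
  proof -
    obtain A' where "y \<in> A'" "triangle_strip r A' \<T>"
      using push.IH[OF base yr(2) y(1)] yr by auto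
    \<comment> \<open>The strip ending at \<open>y\<close> may have another active edge; it is
      turned to the edge \<open>A\<close> of the gluing.\<close>
    then have "triangle_strip r A \<T>"
      using triangle_strip_active_edge[of r A' \<T> y t z] t z zr y by (auto simp: leaves_def)
    then have "triangle_strip r {x, y} (insert (insert x A) \<T>)"
      using push.hyps y by (intro triangle_strip.extend)
    then show ?thesis by auto
  qed
  moreover have "\<exists>A'. r \<in> A' \<and> triangle_strip x A' (insert (insert x A) \<T>)"
  proof -
    obtain A' where "r \<in> A'" "triangle_strip y A' \<T>"
      using push.IH[OF base y(1) yr(2) yr(1)] by auto
    then have "triangle_strip x A' (insert {x, y, z} \<T>)"
      using triangle_strip_prepend push.hyps t z by metis
    with \<open>r \<in> A'\<close> z show ?thesis by auto
  qed
  ultimately show ?case using ends by auto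
qed

subsection \<open>Missed boundaries of triangle-trees\<close>

definition rainbow :: "('v \<Rightarrow> nat) \<Rightarrow> 'v set set \<Rightarrow> bool" where
  "rainbow c \<T> \<longleftrightarrow> (\<forall>t\<in>\<T>. inj_on c t \<and> c ` t \<subseteq> {..<3})"

text \<open>All three colours occur, giving 0 + 1 + 2. Modulo 3 the colouring is thus orthogonal to
  every triangle.\<close>

lemma rainbow_sum:
  assumes "rainbow c \<T>" "t \<in> \<T>" "card t = 3"
  shows "(\<Sum>v\<in>t. int (c v)) = 3"
proof -
  have "inj_on c t" "c ` t \<subseteq> {..<3}" using assms by (auto simp: rainbow_def)
  moreover from this have "c ` t = {..<3}"
    using assms(3) by (intro card_seteq) (auto simp: card_image)
  ultimately have "(\<Sum>v\<in>t. int (c v)) = (\<Sum>i<3. int i)"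
    by (metis sum.reindex_cong)
  then show ?thesis by (simp add: numeral_eq_Suc)
qed

lemma rainbow_exists: "triangle_stack \<T> \<Longrightarrow> \<exists>c. rainbow c \<T>"
proof (induction rule: triangle_stack.induct)
  case (single t)
  then have "finite t" by (intro card_ge_0_finite) simp
  then obtain c where "bij_betw c t {..<3::nat}"
    using single by (metis bij_betw_iff_card card_lessThan finite_lessThan)
  then show ?case by (auto simp: rainbow_def bij_betw_def)
next
  case (push \<T> t A x)
  then obtain c where c: "rainbow c \<T>" by auto
  have A: "inj_on c A" "c ` A \<subseteq> {..<3}"
    using c push.hyps by (auto simp: rainbow_def intro: inj_on_subset)
  have "card (c ` A) = 2" using A push.hyps by (simp add: card_image)
  then have "\<not> {..<3::nat} \<subseteq> c ` A"
    by (metis A(2) card_lessThan numeral_eq_iff num.distinct(5) semiring_norm(83) subset_antisym)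
  then obtain k where k: "k < 3" "k \<notin> c ` A" by auto
  have "rainbow (c(x := k)) (insert (insert x A) \<T>)"
    unfolding rainbow_def
  proof (intro ballI)
    fix t' assume t': "t' \<in> insert (insert x A) \<T>"
    have "x \<notin> A" using push.hyps by auto
    show "inj_on (c(x := k)) t' \<and> (c(x := k)) ` t' \<subseteq> {..<3}"
    proof (cases "t' = insert x A")
      case True
      then show ?thesis using A k \<open>x \<notin> A\<close> by (auto simp: inj_on_def)
    next
      case False
      then have "t' \<in> \<T>" "x \<notin> t'" using t' push.hyps by auto
      then show ?thesis using c by (auto simp: rainbow_def inj_on_def image_subset_iff)
    qed
  qed
  then show ?case by blast
qed

text \<open>One inclusion of the description of the span: combinations with arbitrary integer
  coefficients are orthogonal to the colouring, and by \<open>sum_tri_sum_dvd\<close> to the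
  constants.\<close>

lemma rainbow_tri_sum:
  assumes "triangle_stack \<T>" "rainbow c \<T>"
  shows "3 dvd (\<Sum>v\<in>\<Union>\<T>. int (c v) * tri_sum s \<T> v)"
proof -
  have "(\<Sum>v\<in>\<Union>\<T>. int (c v) * tri_sum s \<T> v) = (\<Sum>t\<in>\<T>. s t * (\<Sum>v\<in>t. int (c v)))"
    using triangle_stack_Union[OF assms(1)] by (intro sum_tri_sum) auto
  also have "\<dots> = (\<Sum>t\<in>\<T>. s t * 3)"
    using rainbow_sum[OF assms(2)] triangle_stack_finite[OF assms(1)] by (intro sum.cong) auto
  finally show ?thesis by (auto intro: dvd_sum)
qed

lemma sum_tri_sum_dvd:
  assumes "triangle_stack \<T>"
  shows "3 dvd (\<Sum>v\<in>\<Union>\<T>. tri_sum s \<T> v)"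
proof -
  have "(\<Sum>v\<in>\<Union>\<T>. 1 * tri_sum s \<T> v) = (\<Sum>t\<in>\<T>. s t * (\<Sum>v\<in>t. 1))"
    using triangle_stack_Union[OF assms(1)] by (intro sum_tri_sum) auto
  also have "\<dots> = (\<Sum>t\<in>\<T>. s t * 3)"
    using triangle_stack_finite[OF assms(1)] by (intro sum.cong) auto
  finally show ?thesis by (auto intro: dvd_sum)
qed

lemma sum_edge:
  fixes f :: "'v \<Rightarrow> int"
  assumes "finite V" "y \<in> V" "z \<in> V"
  shows "(\<Sum>v\<in>V. f v * (of_bool (v = y) - of_bool (v = z))) = f y - f z"
proof -
  have "(\<Sum>v\<in>V. f v * of_bool (v = x)) = f x" if "x \<in> V" for x
    using that assms(1) by (simp add: of_bool_def if_distrib cong: if_cong)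
  then show ?thesis using assms by (simp add: right_diff_distrib sum_subtractf)
qed

text \<open>Pairing with \<open>c\<close> leaves twice the difference of two colours below 3. The
  factor 2 comes from the application, where translates of one boundary in opposite directions are
  subtracted.\<close>

lemma edge_in_span_imp_same_colour:
  assumes "triangle_stack \<T>" "rainbow c \<T>" "y \<in> \<Union>\<T>" "z \<in> \<Union>\<T>"
    "\<And>v. v \<in> \<Union>\<T> \<Longrightarrow> [tri_sum s \<T> v = 2 * (of_bool (v = y) - of_bool (v = z))] (mod 3)"
  shows "c y = c z"
proof -
  have "[(\<Sum>v\<in>\<Union>\<T>. int (c v) * tri_sum s \<T> v) =
      (\<Sum>v\<in>\<Union>\<T>. (2 * int (c v)) * (of_bool (v = y) - of_bool (v = z)))] (mod 3)"
    unfolding mult.assoc mult.left_commute[of 2]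
    by (intro cong_sum cong_mult assms(5) cong_refl)
  also have "(\<Sum>v\<in>\<Union>\<T>. (2 * int (c v)) * (of_bool (v = y) - of_bool (v = z))) =
      2 * int (c y) - 2 * int (c z)"
    using triangle_stack_Union[OF assms(1)] assms(3,4) by (intro sum_edge)
  finally have "3 dvd 2 * int (c y) - 2 * int (c z)"
    using rainbow_tri_sum[OF assms(1,2), of s] cong_dvd_iff by blast
  moreover have "c y < 3" "c z < 3" using assms(2-4) by (auto simp: rainbow_def)
  ultimately show ?thesis by presburger
qed

text \<open>The converse inclusion. The last vertex \<open>x\<close> lies in one triangle only,
  which must therefore get coefficient \<open>b x\<close>; removing this triangle leaves a vector
  with the same two orthogonality properties on the smaller stack.\<close>

lemma in_triangle_span:
  assumes "triangle_stack \<T>" "rainbow c \<T>"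
    "3 dvd (\<Sum>v\<in>\<Union>\<T>. b v)" "3 dvd (\<Sum>v\<in>\<Union>\<T>. int (c v) * b v)"
  shows "\<exists>s. \<forall>v\<in>\<Union>\<T>. [tri_sum s \<T> v = b v] (mod 3)"
  using assms
proof (induction arbitrary: b rule: triangle_stack.induct)
  case (single t)
  then obtain x y z where t: "t = {x, y, z}" "distinct [x, y, z]" by (auto simp: card_3_iff)
  have c: "distinct [c x, c y, c z]" "c x < 3" "c y < 3" "c z < 3"
    using single.prems(1) t by (auto simp: rainbow_def)
  have s1: "3 dvd b x + b y + b z" using single.prems(2) t by (simp add: add.assoc)
  have s2: "3 dvd int (c x) * b x + int (c y) * b y + int (c z) * b z"
    using single.prems(3) t by (simp add: add.assoc)
  have "c x \<in> {0, 1, 2}" "c y \<in> {0, 1, 2}" "c z \<in> {0, 1, 2}" using c by auto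
  \<comment> \<open>For three distinct colours the two conditions force \<open>b\<close> to be
    constant modulo 3; this is checked colour by colour.\<close>
  then have "3 dvd b x - b y \<and> 3 dvd b x - b z"
    using c(1) s1 s2 by (elim insertE emptyE; simp; presburger)
  then show ?case
    using t by (intro exI[of _ "\<lambda>_. b x"]) (simp add: tri_sum_singleton cong_iff_dvd_diff)
next
  case (push \<T> t A x)
  have fin: "finite (\<Union>\<T>)" "finite \<T>"
    using triangle_stack_Union triangle_stack_finite push.hyps by auto
  have x: "x \<notin> A" "insert x A \<notin> \<T>" "finite A" "A \<subseteq> \<Union>\<T>"
    using push.hyps by (auto intro: card_ge_0_finite)
  have c: "rainbow c \<T>" using push.prems by (auto simp: rainbow_def)
  have U: "\<Union>(insert (insert x A) \<T>) = insert x (\<Union>\<T>)" using x by auto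
  define b' where "b' v = b v - b x * of_bool (v \<in> A)" for v
  have restrict: "(\<Sum>v\<in>\<Union>\<T>. f v * (b x * of_bool (v \<in> A))) = b x * sum f A" for f
  proof -
    have "\<Union>\<T> \<inter> A = A" using x by auto
    then show ?thesis
      using fin
      by (simp add: ac_simps sum.If_cases of_bool_def if_distrib sum_distrib_left cong: if_cong)
  qed
  have "(\<Sum>v\<in>\<Union>\<T>. 1 * b' v) = (\<Sum>v\<in>\<Union>\<T>. b v) - b x * 2"
    unfolding b'_def right_diff_distrib sum_subtractf restrict using push.hyps by simp
  moreover have "3 dvd b x + (\<Sum>v\<in>\<Union>\<T>. b v)"
    using push.prems(2) fin push.hyps unfolding U by simp
  ultimately have 1: "3 dvd (\<Sum>v\<in>\<Union>\<T>. b' v)" by simp presburger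
  have "(\<Sum>v\<in>\<Union>\<T>. int (c v) * b' v) = (\<Sum>v\<in>\<Union>\<T>. int (c v) * b v) - b x * (\<Sum>v\<in>A. int (c v))"
    unfolding b'_def right_diff_distrib sum_subtractf restrict ..
  \<comment> \<open>Since the colours sum to 3, subtracting \<open>b x\<close> along
    \<open>A\<close> changes the pairing with \<open>c\<close> by \<open>int (c x) * b x\<close>
    modulo 3, which is exactly the term lost with \<open>x\<close>.\<close>
  moreover have "int (c x) + (\<Sum>v\<in>A. int (c v)) = 3"
    using rainbow_sum[OF push.prems(1), of "insert x A"] x push.hyps by simp
  then have "(\<Sum>v\<in>A. int (c v)) = 3 - int (c x)" by simp
  moreover have "3 dvd int (c x) * b x + (\<Sum>v\<in>\<Union>\<T>. int (c v) * b v)"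
    using push.prems(3) fin push.hyps unfolding U by simp
  ultimately have "3 dvd (\<Sum>v\<in>\<Union>\<T>. int (c v) * b' v) + 3 * b x" by (simp add: algebra_simps)
  then have 2: "3 dvd (\<Sum>v\<in>\<Union>\<T>. int (c v) * b' v)" by presburger
  obtain s where s: "\<forall>v\<in>\<Union>\<T>. [tri_sum s \<T> v = b' v] (mod 3)" using push.IH[OF c 1 2] by blast
  have "[tri_sum (s(insert x A := b x)) (insert (insert x A) \<T>) v = b v] (mod 3)"
    if "v \<in> insert x (\<Union>\<T>)" for v
  proof (cases "v = x")
    case True
    then show ?thesis
      using fin x tri_sum_fresh[of x \<T> s] push.hyps by (simp add: tri_sum_insert tri_sum_upd)
  next
    case False
    then have "[tri_sum s \<T> v = b' v] (mod 3)" using s that by auto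
    then show ?thesis
      using False fin x
      by (auto simp: tri_sum_insert tri_sum_upd b'_def cong_iff_dvd_diff algebra_simps)
  qed
  then show ?case unfolding U by blast
qed

section \<open>Triangle-trees in terms of their triangles\<close>

text \<open>The offset 1 in the degree is that of a single triangle. It persists: gluing raises
  degree and triangle count of both old ends by one, and the new vertex has degree 2 in one
  triangle.\<close>

definition triangulates :: "'v set set \<Rightarrow> ('v, 'e) mgraph \<Rightarrow> bool" where
  "triangulates \<T> T \<longleftrightarrow> triangle_stack \<T> \<and> mverts T = \<Union>\<T> \<and>
    (\<forall>y z. madjacent T y z \<longleftrightarrow> y \<noteq> z \<and> (\<exists>t\<in>\<T>. {y, z} \<subseteq> t)) \<and>
    (\<forall>v\<in>mverts T. int (vertex_degree T v) = 1 + tri_sum (\<lambda>_. 1) \<T> v)"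

definition sign_combination :: "'v set set \<Rightarrow> ('v \<Rightarrow> int) \<Rightarrow> bool" where
  "sign_combination \<T> \<beta> \<longleftrightarrow> (\<exists>s. signs s \<and> (\<forall>v\<in>\<Union>\<T>. [tri_sum s \<T> v = \<beta> v] (mod 3)))"

lemma sign_combination_single: "sign_combination {t} \<beta> \<longleftrightarrow> (\<exists>k\<in>{1, - 1}. \<forall>v\<in>t. [\<beta> v = k] (mod 3))"
proof
  assume "sign_combination {t} \<beta>"
  then obtain s where "signs s" "\<forall>v\<in>t. [s t = \<beta> v] (mod 3)"
    by (auto simp: sign_combination_def tri_sum_singleton)
  then show "\<exists>k\<in>{1, - 1}. \<forall>v\<in>t. [\<beta> v = k] (mod 3)"
    using signsD[of s t] by (intro bexI[of _ "s t"]) (auto simp: cong_sym)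
next
  assume "\<exists>k\<in>{1, - 1}. \<forall>v\<in>t. [\<beta> v = k] (mod 3)"
  then obtain k where "k \<in> {1, - 1}" "\<forall>v\<in>t. [\<beta> v = k] (mod 3)" by blast
  then show "sign_combination {t} \<beta>"
    by (auto simp: sign_combination_def tri_sum_singleton signs_def cong_sym intro!: exI[of _ "\<lambda>_. k"])
qed

text \<open>The sign of the new triangle is read off at \<open>x\<close>, which no other triangle
  contains; its effect on \<open>y\<close> and \<open>z\<close> is subtracted before passing to the
  old triangles.\<close>

lemma sign_combination_insert:
  assumes "finite \<T>" "x \<notin> \<Union>\<T>" "y \<in> \<Union>\<T>" "z \<in> \<Union>\<T>" "y \<noteq> z"
  shows "sign_combination (insert {x, y, z} \<T>) \<beta> \<longleftrightarrow> (\<exists>k\<in>{1, - 1}. [\<beta> x = k] (mod 3) \<and>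
    sign_combination \<T> (\<lambda>v. \<beta> v - k * of_bool (v = y) - k * of_bool (v = z)))"
proof -
  have new: "{x, y, z} \<notin> \<T>" "x \<noteq> y" "x \<noteq> z" using assms by auto
  have U: "\<Union>(insert {x, y, z} \<T>) = insert x (\<Union>\<T>)" using assms by auto
  have at_x: "tri_sum s (insert {x, y, z} \<T>) x = s {x, y, z}" for s
    using assms new tri_sum_fresh[of x \<T> s] by (simp add: tri_sum_insert)
  have at_v: "tri_sum s (insert {x, y, z} \<T>) v =
      s {x, y, z} * of_bool (v = y) + s {x, y, z} * of_bool (v = z) + tri_sum s \<T> v"
    if "v \<in> \<Union>\<T>" for s v
    using assms new that by (auto simp: tri_sum_insert)
  show ?thesis
  proof
    assume "sign_combination (insert {x, y, z} \<T>) \<beta>"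
    then obtain s where s: "signs s"
      "\<forall>v\<in>insert x (\<Union>\<T>). [tri_sum s (insert {x, y, z} \<T>) v = \<beta> v] (mod 3)"
      unfolding sign_combination_def U by blast
    define k where "k = s {x, y, z}"
    have "[\<beta> x = k] (mod 3)" using s(2) at_x[of s] by (simp add: k_def cong_sym_eq)
    moreover have "[tri_sum s \<T> v = \<beta> v - k * of_bool (v = y) - k * of_bool (v = z)] (mod 3)"
      if "v \<in> \<Union>\<T>" for v
    proof -
      have "[tri_sum s (insert {x, y, z} \<T>) v = \<beta> v] (mod 3)" using s(2) that by blast
      then show ?thesis unfolding at_v[OF that] by (simp add: k_def cong_iff_dvd_diff algebra_simps)
    qed
    moreover have "k \<in> {1, - 1}" using signsD[OF s(1)] by (simp add: k_def)
    ultimately show "\<exists>k\<in>{1, - 1}. [\<beta> x = k] (mod 3) \<and>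
        sign_combination \<T> (\<lambda>v. \<beta> v - k * of_bool (v = y) - k * of_bool (v = z))"
      unfolding sign_combination_def using s(1) by blast
  next
    assume "\<exists>k\<in>{1, - 1}. [\<beta> x = k] (mod 3) \<and>
        sign_combination \<T> (\<lambda>v. \<beta> v - k * of_bool (v = y) - k * of_bool (v = z))"
    then obtain k s where k: "k \<in> {1, - 1}" "[\<beta> x = k] (mod 3)" and s: "signs s"
      "\<forall>v\<in>\<Union>\<T>. [tri_sum s \<T> v = \<beta> v - k * of_bool (v = y) - k * of_bool (v = z)] (mod 3)"
      unfolding sign_combination_def by blast
    define s' where "s' = s({x, y, z} := k)"
    have s': "tri_sum s' \<T> = tri_sum s \<T>" "s' {x, y, z} = k"
      using new by (simp_all add: s'_def tri_sum_upd)
    have "[tri_sum s' (insert {x, y, z} \<T>) v = \<beta> v] (mod 3)" if "v \<in> insert x (\<Union>\<T>)" for v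
    proof (cases "v = x")
      case True
      then show ?thesis using k at_x[of s'] s' by (simp add: cong_sym_eq)
    next
      case False
      then have v: "v \<in> \<Union>\<T>" using that by simp
      have "[tri_sum s \<T> v = \<beta> v - k * of_bool (v = y) - k * of_bool (v = z)] (mod 3)"
        using s(2) v by blast
      then show ?thesis unfolding at_v[OF v] s' by (simp add: cong_iff_dvd_diff algebra_simps)
    qed
    moreover have "signs s'" using s(1) k(1) unfolding s'_def by (rule signs_upd)
    ultimately show "sign_combination (insert {x, y, z} \<T>) \<beta>" unfolding sign_combination_def U by blast
  qed
qed

text \<open>The difference of the two combinations is again a combination of triangles, now equal
  modulo 3 to twice the edge vector.\<close>

lemma sign_combination_translates_imp_same_colour:
  assumes "triangle_stack \<T>" "rainbow c \<T>" "y \<in> \<Union>\<T>" "z \<in> \<Union>\<T>"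
    "sign_combination \<T> (\<lambda>v. \<beta> v + (of_bool (v = y) - of_bool (v = z)))"
    "sign_combination \<T> (\<lambda>v. \<beta> v - (of_bool (v = y) - of_bool (v = z)))"
  shows "c y = c z"
proof -
  obtain s s' where
    "\<forall>v\<in>\<Union>\<T>. [tri_sum s \<T> v = \<beta> v + (of_bool (v = y) - of_bool (v = z))] (mod 3)"
    "\<forall>v\<in>\<Union>\<T>. [tri_sum s' \<T> v = \<beta> v - (of_bool (v = y) - of_bool (v = z))] (mod 3)"
    using assms(5,6) unfolding sign_combination_def by blast
  then have "[tri_sum (\<lambda>t. s t - s' t) \<T> v = (\<beta> v + (of_bool (v = y) - of_bool (v = z))) -
      (\<beta> v - (of_bool (v = y) - of_bool (v = z)))] (mod 3)" if "v \<in> \<Union>\<T>" for v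
    unfolding tri_sum_diff using that by (intro cong_diff) blast+
  then show ?thesis
    by (intro edge_in_span_imp_same_colour[OF assms(1-4), of "\<lambda>t. s t - s' t"]) simp
qed

lemma triangulates_triangle:
  assumes "distinct [x, y, z]" "distinct [a, b, c]" "\<phi> a = {y, z}" "\<phi> b = {x, z}" "\<phi> c = {x, y}"
  shows "triangulates {{x, y, z}} \<lparr>mverts = {x, y, z}, medges = {a, b, c}, mends = \<phi>\<rparr>"
proof -
  have "{e. (e = a \<or> e = b \<or> e = c) \<and> x \<in> \<phi> e} = {b, c}"
    "{e. (e = a \<or> e = b \<or> e = c) \<and> y \<in> \<phi> e} = {a, c}"
    "{e. (e = a \<or> e = b \<or> e = c) \<and> z \<in> \<phi> e} = {a, b}"
    using assms by auto
  then have "\<forall>v\<in>{x, y, z}. int (card {e. (e = a \<or> e = b \<or> e = c) \<and> v \<in> \<phi> e}) = 2"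
    using assms(2) by auto
  moreover have "triangle_stack {{x, y, z}}" using assms by (intro triangle_stack.single) auto
  ultimately show ?thesis
    using assms
    by (auto simp: triangulates_def vertex_degree_def madjacent_def tri_sum_singleton
        doubleton_eq_iff)
qed

lemma triangulates_add_vertex:
  assumes "triangulates \<T> T" "loopfree_mgraph T" "x \<notin> mverts T" "madjacent T y z"
    "a \<notin> medges T" "b \<notin> medges T" "a \<noteq> b" "mends T a = {x, y}" "mends T b = {x, z}"
  shows "triangulates (insert {x, y, z} \<T>)
    (T\<lparr>mverts := insert x (mverts T), medges := insert a (insert b (medges T))\<rparr>)"
    (is "triangulates _ ?T'")
proof -
  interpret loopfree_mgraph T by fact
  have T: "triangle_stack \<T>" "mverts T = \<Union>\<T>"
    and adj: "\<And>y z. madjacent T y z \<longleftrightarrow> y \<noteq> z \<and> (\<exists>t\<in>\<T>. {y, z} \<subseteq> t)"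
    and deg: "\<And>v. v \<in> mverts T \<Longrightarrow> int (vertex_degree T v) = 1 + tri_sum (\<lambda>_. 1) \<T> v"
    using assms(1) by (auto simp: triangulates_def)
  from adj[of y z] assms(4) obtain t where t: "y \<noteq> z" "t \<in> \<T>" "{y, z} \<subseteq> t" by auto
  have x: "x \<notin> \<Union>\<T>" using assms(3) T by simp
  have new: "{x, y, z} \<notin> \<T>" "x \<noteq> y" "x \<noteq> z" using x t by auto
  have "triangle_stack (insert (insert x {y, z}) \<T>)"
    using T t x by (intro triangle_stack.push) auto
  moreover have "mverts ?T' = \<Union>(insert {x, y, z} \<T>)" using T t by auto
  moreover have "madjacent ?T' p q \<longleftrightarrow> p \<noteq> q \<and> (\<exists>t\<in>insert {x, y, z} \<T>. {p, q} \<subseteq> t)" for p q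
  proof -
    have "madjacent ?T' p q \<longleftrightarrow> {x, y} = {p, q} \<or> {x, z} = {p, q} \<or> madjacent T p q"
      using assms by (auto simp: madjacent_def)
    then show ?thesis
      using adj[of p q] adj[of y z] adj[of z y] t new by (auto simp: doubleton_eq_iff)
  qed
  moreover have "int (vertex_degree ?T' v) = 1 + tri_sum (\<lambda>_. 1) (insert {x, y, z} \<T>) v"
    if "v \<in> mverts ?T'" for v
  proof -
    have "{e \<in> medges ?T'. v \<in> mends ?T' e} =
      {e \<in> {a}. v \<in> {x, y}} \<union> ({e \<in> {b}. v \<in> {x, z}} \<union> {e \<in> medges T. v \<in> mends T e})"
      using assms by auto
    also have "card \<dots> = of_bool (v \<in> {x, y}) + (of_bool (v \<in> {x, z}) + vertex_degree T v)"
      using assms finite_medges unfolding vertex_degree_def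
      by (subst card_Un_disjoint, simp, simp, force, subst card_Un_disjoint) (auto simp: card_insert_if)
    finally have d: "vertex_degree ?T' v =
        of_bool (v \<in> {x, y}) + (of_bool (v \<in> {x, z}) + vertex_degree T v)"
      by (simp add: vertex_degree_def)
    have s: "tri_sum (\<lambda>_. 1) (insert {x, y, z} \<T>) v = of_bool (v \<in> {x, y, z}) + tri_sum (\<lambda>_. 1) \<T> v"
      using new triangle_stack_finite[OF T(1)] by (simp add: tri_sum_insert)
    show ?thesis
    proof (cases "v = x")
      case True
      have "{e \<in> medges T. x \<in> mends T e} = {}" using mends_in_mverts assms(3) by auto
      then have "vertex_degree T x = 0" by (simp only: vertex_degree_def card.empty)
      then show ?thesis
        using True d s tri_sum_fresh[OF x, of "\<lambda>_. 1"] by simp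
    next
      case False
      then show ?thesis using that d s deg[of v] new t(1) by auto
    qed
  qed
  ultimately show ?thesis unfolding triangulates_def by blast
qed

text \<open>With equal colours the edge vector \<open>d\<close> is orthogonal to constants and
  colouring, hence a combination with some coefficients \<open>k\<close>. Modulo 3 every
  \<open>2 * k t\<close> is a difference of two signs, and \<open>\<beta>\<close> lies midway
  between the two resulting sign combinations.\<close>

lemma same_colour_imp_sign_combination_translates:
  assumes "triangle_stack \<T>" "rainbow c \<T>" "u \<in> \<Union>\<T>" "w \<in> \<Union>\<T>" "c u = c w"
  shows "\<exists>\<beta>. 3 dvd (\<Sum>v\<in>\<Union>\<T>. \<beta> v) \<and>
    sign_combination \<T> (\<lambda>v. \<beta> v + (of_bool (v = u) - of_bool (v = w))) \<and>
    sign_combination \<T> (\<lambda>v. \<beta> v - (of_bool (v = u) - of_bool (v = w)))"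
proof -
  define d where "d v = (of_bool (v = u) - of_bool (v = w) :: int)" for v
  have fin: "finite (\<Union>\<T>)" using triangle_stack_Union assms(1) by auto
  have sum_d: "(\<Sum>v\<in>\<Union>\<T>. d v) = 0"
    using sum_edge[OF fin assms(3,4), of "\<lambda>_. 1"] by (simp add: d_def)
  have "(\<Sum>v\<in>\<Union>\<T>. int (c v) * d v) = 0"
    using sum_edge[OF fin assms(3,4), of "\<lambda>v. int (c v)"] assms(5) by (simp add: d_def)
  then obtain k where k: "\<forall>v\<in>\<Union>\<T>. [tri_sum k \<T> v = d v] (mod 3)"
    using in_triangle_span[OF assms(1,2), of d] sum_d by auto
  \<comment> \<open>Signs with \<open>s t - s' t\<close> congruent to \<open>2 * k t\<close>: both
    are 1 for residue 0, they are 1 and -1 for residue 1, and -1 and 1 for residue 2.\<close>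
  define s where "s t = (if k t mod 3 = 2 then - 1 else 1 :: int)" for t
  define s' where "s' t = (if k t mod 3 = 1 then - 1 else 1 :: int)" for t
  have signs: "signs s" "signs s'" by (auto simp: signs_def s_def s'_def)
  have "[s t - s' t = k t + k t] (mod 3)" for t
    unfolding s_def s'_def cong_iff_dvd_diff by (simp; presburger)
  then have "[tri_sum (\<lambda>t. s t - s' t) \<T> v = tri_sum (\<lambda>t. k t + k t) \<T> v] (mod 3)" for v
    by (rule tri_sum_cong_mod)
  moreover have "tri_sum (\<lambda>t. k t + k t) \<T> v = tri_sum k \<T> v + tri_sum k \<T> v" for v
    by (simp only: tri_sum_def distrib_right sum.distrib)
  ultimately have diff: "[tri_sum s \<T> v - tri_sum s' \<T> v = d v + d v] (mod 3)" if "v \<in> \<Union>\<T>" for v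
    using k that unfolding tri_sum_diff by (metis cong_add cong_trans)
  define \<beta> where "\<beta> v = tri_sum s \<T> v - d v" for v
  have "3 dvd (\<Sum>v\<in>\<Union>\<T>. \<beta> v)"
    using sum_tri_sum_dvd[OF assms(1), of s] sum_d by (simp add: \<beta>_def sum_subtractf)
  moreover have "sign_combination \<T> (\<lambda>v. \<beta> v + d v)"
    unfolding sign_combination_def by (intro exI[of _ s]) (simp add: signs \<beta>_def)
  moreover have "[tri_sum s' \<T> v = \<beta> v - d v] (mod 3)" if "v \<in> \<Union>\<T>" for v
    using diff[OF that] unfolding \<beta>_def cong_iff_dvd_diff
    by (auto dest: dvd_minus_iff[THEN iffD2] simp: algebra_simps)
  then have "sign_combination \<T> (\<lambda>v. \<beta> v - d v)"
    unfolding sign_combination_def using signs(2) by blast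
  ultimately show ?thesis unfolding d_def by blast
qed

text \<open>The cyclic orientations attain 0 and the six transitive ones attain the six arrangements
  of the residues 0, 1, 2. Of the nine boundaries modulo 3 this leaves the constants 1 and -1. The
  proof is a finite check on the residues \<open>\<gamma>\<close>.\<close>

lemma attains_triangle:
  assumes "distinct [x, y, z]" "distinct [a, b, c]" "\<phi> a = {y, z}" "\<phi> b = {x, z}" "\<phi> c = {x, y}"
    "Z3_boundary \<lparr>mverts = {x, y, z}, medges = {a, b, c}, mends = \<phi>\<rparr> \<beta>"
  shows "attains \<lparr>mverts = {x, y, z}, medges = {a, b, c}, mends = \<phi>\<rparr> \<beta> \<longleftrightarrow> \<not> sign_combination {{x, y, z}} \<beta>"
proof -
  let ?G = "\<lambda>E. \<lparr>mverts = {x, y, z}, medges = E, mends = \<phi>\<rparr>"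
  have add: "attains (?G (insert e E)) \<beta> \<longleftrightarrow>
      attains (?G E) (\<lambda>v. \<beta> v + (of_bool (v = u) - of_bool (v = w))) \<or>
      attains (?G E) (\<lambda>v. \<beta> v - (of_bool (v = u) - of_bool (v = w)))"
    if "finite E" "e \<notin> E" "\<phi> e = {u, w}" for e E u w \<beta>
    using attains_add_edge[of "?G E" e u w \<beta>] that by simp
  have no_edges: "attains (?G {}) \<beta> \<longleftrightarrow> (\<forall>v\<in>{x, y, z}. 3 dvd \<beta> v)" for \<beta>
    by (simp add: attains_def cong_0_iff cong_sym_eq[of 0])
  have "a \<notin> {b, c}" "b \<notin> {c}" "c \<notin> {}" using assms(2) by auto
  note steps = add[OF _ this(1) assms(3), simplified] add[OF _ this(2) assms(4), simplified]
    add[OF _ this(3) assms(5), simplified]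
  have distinct: "x \<noteq> y" "x \<noteq> z" "y \<noteq> z" using assms(1) by auto
  define \<gamma> where "\<gamma> v = \<beta> v mod 3" for v
  have "\<gamma> x \<in> {0, 1, 2}" "\<gamma> y \<in> {0, 1, 2}" "\<gamma> z \<in> {0, 1, 2}"
    unfolding \<gamma>_def by auto
  moreover have "3 dvd \<beta> x + \<beta> y + \<beta> z"
    using assms(1,6) by (simp add: Z3_boundary_def cong_0_iff add.assoc)
  then have "3 dvd \<gamma> x + \<gamma> y + \<gamma> z" unfolding \<gamma>_def by presburger
  \<comment> \<open>\<open>k\<close>, \<open>l\<close>, \<open>m\<close> encode the directions of
    \<open>a\<close>, \<open>b\<close>, \<open>c\<close>; once all edges are removed, only zero is
    attained.\<close>
  moreover have "attains (?G {a, b, c}) \<gamma> \<longleftrightarrow>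
    (\<exists>k\<in>{1, - 1}. \<exists>l\<in>{1, - 1}. \<exists>m\<in>{1, - 1}.
      3 dvd \<gamma> x + l + m \<and> 3 dvd \<gamma> y + k - m \<and> 3 dvd \<gamma> z - k - l)"
    unfolding steps no_edges using distinct distinct[symmetric] by (simp add: disj_assoc algebra_simps)
  ultimately have "attains (?G {a, b, c}) \<gamma> \<longleftrightarrow> \<not> sign_combination {{x, y, z}} \<gamma>"
    by (elim insertE emptyE; simp add: sign_combination_single cong_iff_dvd_diff)
  moreover have "attains (?G {a, b, c}) \<gamma> \<longleftrightarrow> attains (?G {a, b, c}) \<beta>"
    by (intro attains_cong) (simp add: \<gamma>_def)
  moreover have "sign_combination {{x, y, z}} \<gamma> \<longleftrightarrow> sign_combination {{x, y, z}} \<beta>"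
    by (simp add: sign_combination_single \<gamma>_def)
  ultimately show ?thesis by blast
qed

text \<open>If \<open>\<beta> x\<close> is 1 or -1 modulo 3, both new edges point the same way at
  \<open>x\<close>, and the shift at \<open>y\<close> and \<open>z\<close> is the one in
  \<open>sign_combination_insert\<close>. If it is 0, one edge enters and one leaves, in two ways;
  both failing would give the adjacent vertices \<open>y\<close> and \<open>z\<close> the same
  colour.\<close>

lemma triangle_tree_attains_iff:
  assumes "triangle_tree T"
  shows "\<exists>\<T>. triangulates \<T> T \<and>
    (\<forall>\<beta>. Z3_boundary T \<beta> \<longrightarrow> (attains T \<beta> \<longleftrightarrow> \<not> sign_combination \<T> \<beta>))"
  using assms
proof (induction rule: triangle_tree.induct)
  case (triangle x y z a b c \<phi>)
  then show ?case
    by (intro exI[of _ "{{x, y, z}}"]) (simp add: triangulates_triangle attains_triangle)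
next
  case (add_vertex T x y z a b)
  then obtain \<T> where \<T>: "triangulates \<T> T"
    and IH: "\<And>\<beta>. Z3_boundary T \<beta> \<Longrightarrow> attains T \<beta> \<longleftrightarrow> \<not> sign_combination \<T> \<beta>" by blast
  have stack: "triangle_stack \<T>" and V: "mverts T = \<Union>\<T>" using \<T> by (auto simp: triangulates_def)
  obtain t where t: "y \<noteq> z" "t \<in> \<T>" "{y, z} \<subseteq> t"
    using \<T> add_vertex.hyps by (auto simp: triangulates_def)
  have loopfree: "loopfree_mgraph T" using add_vertex.hyps(1) by (rule triangle_tree_loopfree)
  interpret loopfree_mgraph T by (rule loopfree)
  let ?T' = "T\<lparr>mverts := insert x (mverts T), medges := insert a (insert b (medges T))\<rparr>"
  let ?T1 = "T\<lparr>mverts := insert x (mverts T)\<rparr>"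
  let ?T2 = "T\<lparr>mverts := insert x (mverts T), medges := insert b (medges T)\<rparr>"
  have x: "x \<notin> \<Union>\<T>" "x \<noteq> y" "x \<noteq> z" using add_vertex.hyps(2) V t by auto
  have yz: "y \<in> \<Union>\<T>" "z \<in> \<Union>\<T>" using t by auto
  have vertex: "attains ?T1 \<beta> \<longleftrightarrow> [\<beta> x = 0] (mod 3) \<and> attains T \<beta>" for \<beta>
    using attains_add_vertex add_vertex.hyps(2) by simp
  have edge_b: "attains ?T2 \<beta> \<longleftrightarrow>
      attains ?T1 (\<lambda>v. \<beta> v + (of_bool (v = x) - of_bool (v = z))) \<or>
      attains ?T1 (\<lambda>v. \<beta> v - (of_bool (v = x) - of_bool (v = z)))" for \<beta>
    using attains_add_edge[of ?T1 b x z \<beta>] add_vertex.hyps finite_medges by simp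
  have edge_a: "attains ?T' \<beta> \<longleftrightarrow>
      attains ?T2 (\<lambda>v. \<beta> v + (of_bool (v = x) - of_bool (v = y))) \<or>
      attains ?T2 (\<lambda>v. \<beta> v - (of_bool (v = x) - of_bool (v = y)))" for \<beta>
    using attains_add_edge[of ?T2 a x y \<beta>] add_vertex.hyps finite_medges by simp
  \<comment> \<open>\<open>k\<close> and \<open>l\<close> are what the new edges contribute at
    \<open>y\<close> and \<open>z\<close>; \<open>x\<close> then receives
    \<open>- k - l\<close>.\<close>
  define B where "B \<beta> k l = attains T (\<lambda>v. \<beta> v - k * of_bool (v = y) - l * of_bool (v = z))"
    for \<beta> and k l :: int
  have B: "attains T \<gamma> \<longleftrightarrow> B \<beta> k l"
    if "\<And>v. v \<noteq> x \<Longrightarrow> \<gamma> v = \<beta> v - k * of_bool (v = y) - l * of_bool (v = z)" for \<beta> \<gamma> k l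
    unfolding B_def using that add_vertex.hyps(2) by (intro attains_cong) (metis cong_refl)
  \<comment> \<open>Equal contributions \<open>k\<close> give \<open>x\<close> the value
    \<open>- 2 * k\<close>, which is \<open>k\<close> modulo 3; opposite ones give 0.\<close>
  have steps: "attains ?T' \<beta> \<longleftrightarrow>
      [\<beta> x = 1] (mod 3) \<and> B \<beta> 1 1 \<or> [\<beta> x = - 1] (mod 3) \<and> B \<beta> (- 1) (- 1) \<or>
      [\<beta> x = 0] (mod 3) \<and> (B \<beta> 1 (- 1) \<or> B \<beta> (- 1) 1)" for \<beta>
  proof -
    have 1: "attains T (\<lambda>v. \<beta> v + (of_bool (v = x) - of_bool (v = y)) + (of_bool (v = x) - of_bool (v = z)))
        = B \<beta> 1 1" by (rule B) simp
    have 2: "attains T (\<lambda>v. \<beta> v + (of_bool (v = x) - of_bool (v = y)) - (of_bool (v = x) - of_bool (v = z)))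
        = B \<beta> 1 (- 1)" by (rule B) simp
    have 3: "attains T (\<lambda>v. \<beta> v - (of_bool (v = x) - of_bool (v = y)) + (of_bool (v = x) - of_bool (v = z)))
        = B \<beta> (- 1) 1" by (rule B) simp
    have 4: "attains T (\<lambda>v. \<beta> v - (of_bool (v = x) - of_bool (v = y)) - (of_bool (v = x) - of_bool (v = z)))
        = B \<beta> (- 1) (- 1)" by (rule B) simp
    have "[\<beta> x + 1 + 1 = 0] (mod 3) \<longleftrightarrow> [\<beta> x = 1] (mod 3)"
      "[\<beta> x - 1 - 1 = 0] (mod 3) \<longleftrightarrow> [\<beta> x = - 1] (mod 3)"
      unfolding cong_iff_dvd_diff by presburger+
    then show ?thesis
      unfolding edge_a edge_b vertex 1 2 3 4 using x by auto
  qed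
  have "attains ?T' \<beta> \<longleftrightarrow> \<not> sign_combination (insert {x, y, z} \<T>) \<beta>" if "Z3_boundary ?T' \<beta>" for \<beta>
  proof -
    have bd: "3 dvd \<beta> x + (\<Sum>v\<in>\<Union>\<T>. \<beta> v)"
      using that x(1) finite_mverts by (simp add: Z3_boundary_def cong_0_iff V)
    \<comment> \<open>The congruence makes the remainder on \<open>T\<close> a boundary, so that the
      induction hypothesis applies.\<close>
    have B_iff: "B \<beta> k l \<longleftrightarrow>
        \<not> sign_combination \<T> (\<lambda>v. \<beta> v - k * of_bool (v = y) - l * of_bool (v = z))"
      if "[\<beta> x = - k - l] (mod 3)" for k l
    proof -
      have "(\<Sum>v\<in>\<Union>\<T>. k * of_bool (v = y)) = k" "(\<Sum>v\<in>\<Union>\<T>. l * of_bool (v = z)) = l"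
        using yz finite_mverts by (simp_all add: V of_bool_def if_distrib cong: if_cong)
      then have "(\<Sum>v\<in>\<Union>\<T>. \<beta> v - k * of_bool (v = y) - l * of_bool (v = z)) = sum \<beta> (\<Union>\<T>) - k - l"
        by (simp add: sum_subtractf)
      moreover have "3 dvd sum \<beta> (\<Union>\<T>) - k - l"
        using bd that unfolding cong_iff_dvd_diff by presburger
      ultimately have "Z3_boundary T (\<lambda>v. \<beta> v - k * of_bool (v = y) - l * of_bool (v = z))"
        unfolding Z3_boundary_def cong_0_iff V by simp
      then show ?thesis unfolding B_def by (rule IH)
    qed
    obtain c where c: "rainbow c \<T>" using rainbow_exists[OF stack] by blast
    have "c y \<noteq> c z" using c t by (auto simp: rainbow_def inj_on_def)
    then have edge: "\<not> (sign_combination \<T> (\<lambda>v. \<beta> v + (of_bool (v = y) - of_bool (v = z))) \<and>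
        sign_combination \<T> (\<lambda>v. \<beta> v - (of_bool (v = y) - of_bool (v = z))))"
      using sign_combination_translates_imp_same_colour[OF stack c yz] by blast
    have zero: "B \<beta> 1 (- 1) \<or> B \<beta> (- 1) 1" if "[\<beta> x = 0] (mod 3)"
    proof -
      have "(\<lambda>v. \<beta> v - 1 * of_bool (v = y) - (- 1) * of_bool (v = z)) =
          (\<lambda>v. \<beta> v - (of_bool (v = y) - of_bool (v = z)))"
        "(\<lambda>v. \<beta> v - (- 1) * of_bool (v = y) - 1 * of_bool (v = z)) =
          (\<lambda>v. \<beta> v + (of_bool (v = y) - of_bool (v = z)))"
        by auto
      then show ?thesis using edge B_iff[of 1 "- 1"] B_iff[of "- 1" 1] that by auto
    qed
    have one: "B \<beta> 1 1 \<longleftrightarrow> \<not> sign_combination \<T> (\<lambda>v. \<beta> v - 1 * of_bool (v = y) - 1 * of_bool (v = z))"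
      if "[\<beta> x = 1] (mod 3)"
      using that unfolding cong_iff_dvd_diff by (intro B_iff) (simp add: cong_iff_dvd_diff, presburger)
    have two: "B \<beta> (- 1) (- 1) \<longleftrightarrow>
        \<not> sign_combination \<T> (\<lambda>v. \<beta> v - (- 1) * of_bool (v = y) - (- 1) * of_bool (v = z))"
      if "[\<beta> x = - 1] (mod 3)"
      using that unfolding cong_iff_dvd_diff by (intro B_iff) (simp add: cong_iff_dvd_diff, presburger)
    have insert: "sign_combination (insert {x, y, z} \<T>) \<beta> \<longleftrightarrow>
      [\<beta> x = 1] (mod 3) \<and> sign_combination \<T> (\<lambda>v. \<beta> v - 1 * of_bool (v = y) - 1 * of_bool (v = z)) \<or>
      [\<beta> x = - 1] (mod 3) \<and> sign_combination \<T> (\<lambda>v. \<beta> v - (- 1) * of_bool (v = y) - (- 1) * of_bool (v = z))"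
      using triangle_stack_finite[OF stack] x yz t by (subst sign_combination_insert) auto
    have "[\<beta> x = 0] (mod 3) \<and> \<not> [\<beta> x = 1] (mod 3) \<and> \<not> [\<beta> x = - 1] (mod 3) \<or>
        [\<beta> x = 1] (mod 3) \<and> \<not> [\<beta> x = 0] (mod 3) \<and> \<not> [\<beta> x = - 1] (mod 3) \<or>
        [\<beta> x = - 1] (mod 3) \<and> \<not> [\<beta> x = 0] (mod 3) \<and> \<not> [\<beta> x = 1] (mod 3)"
      unfolding cong_iff_dvd_diff by presburger
    then consider "[\<beta> x = 0] (mod 3)" "\<not> [\<beta> x = 1] (mod 3)" "\<not> [\<beta> x = - 1] (mod 3)"
      | "[\<beta> x = 1] (mod 3)" "\<not> [\<beta> x = 0] (mod 3)" "\<not> [\<beta> x = - 1] (mod 3)"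
      | "[\<beta> x = - 1] (mod 3)" "\<not> [\<beta> x = 0] (mod 3)" "\<not> [\<beta> x = 1] (mod 3)"
      by blast
    then show ?thesis
      unfolding steps insert using zero one two by cases blast+
  qed
  moreover have "triangulates (insert {x, y, z} \<T>) ?T'"
    using \<T> loopfree add_vertex.hyps by (intro triangulates_add_vertex)
  ultimately show ?case by blast
qed

section \<open>From triangle-paths to crystals\<close>

lemma proper_colouring_iff_rainbow:
  "triangulates \<T> T \<Longrightarrow> (\<forall>v\<in>mverts T. c v < 3) \<and>
    (\<forall>u\<in>mverts T. \<forall>v\<in>mverts T. madjacent T u v \<longrightarrow> c u \<noteq> c v) \<longleftrightarrow> rainbow c \<T>"
  unfolding triangulates_def rainbow_def inj_on_def by (auto simp: image_subset_iff) (metis+)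

text \<open>The sums along the strip lie between -1 and 1, forced in one direction and chosen so in
  the other. For such values vanishing modulo 3, vanishing and being even coincide, and parity
  depends only on the number of triangles.\<close>

lemma sign_combination_edge_iff_even:
  assumes "triangle_stack \<T>" "triangle_strip u A \<T>" "w \<in> A" "u \<in> leaves \<T>" "w \<in> leaves \<T>"
  shows "sign_combination \<T> (\<lambda>v. of_bool (v = u) - of_bool (v = w)) \<longleftrightarrow>
    (\<forall>v\<in>\<Union>\<T> - {u, w}. even (tri_sum (\<lambda>_. 1) \<T> v))"
proof
  have "u \<notin> A" using triangle_strip_basic[OF assms(2)] by blast
  then have uw: "u \<noteq> w" using assms(3) by blast
  {
    assume "sign_combination \<T> (\<lambda>v. of_bool (v = u) - of_bool (v = w))"
    then obtain s where s: "signs s"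
      "\<forall>v\<in>\<Union>\<T>. [tri_sum s \<T> v = of_bool (v = u) - of_bool (v = w)] (mod 3)"
      unfolding sign_combination_def by blast
    have zero: "[tri_sum s \<T> v = 0] (mod 3)" if "v \<in> \<Union>\<T>" "v \<noteq> u" "v \<noteq> w" for v
      using s(2)[rule_format, OF that(1)] that by simp
    then have small: "tri_sum s \<T> v \<in> {- 1, 0, 1}" for v
      using triangle_strip_tri_sum[OF assms(2) s(1)] assms(3) by blast
    show "\<forall>v\<in>\<Union>\<T> - {u, w}. even (tri_sum (\<lambda>_. 1) \<T> v)"
    proof
      fix v assume "v \<in> \<Union>\<T> - {u, w}"
      then have "[tri_sum s \<T> v = 0] (mod 3)" by (intro zero) auto
      then have "tri_sum s \<T> v = 0" using small[of v] by (auto simp: cong_def)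
      then show "even (tri_sum (\<lambda>_. 1) \<T> v)" using tri_sum_parity[OF s(1), of \<T> v] by simp
    qed
  next
    assume even: "\<forall>v\<in>\<Union>\<T> - {u, w}. even (tri_sum (\<lambda>_. 1) \<T> v)"
    obtain s where s: "signs s" and small: "\<And>v. tri_sum s \<T> v \<in> {- 1, 0, 1}"
      using triangle_strip_signs[OF assms(2)] by blast
    have fin: "finite (\<Union>\<T>)" using triangle_stack_Union assms(1) by auto
    have in_V: "u \<in> \<Union>\<T>" "w \<in> \<Union>\<T>" using assms(4,5) by (auto simp: leaves_def)
    have zero: "tri_sum s \<T> v = 0" if "v \<in> \<Union>\<T> - {u, w}" for v
    proof -
      have "even (tri_sum s \<T> v)" using even that tri_sum_parity[OF s, of \<T> v] by blast
      then show ?thesis using small[of v] by auto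
    qed
    have ends: "tri_sum s \<T> v \<in> {- 1, 1}" if "v \<in> leaves \<T>" for v
    proof -
      have "odd (tri_sum s \<T> v)" using that tri_sum_parity[OF s, of \<T> v] by (simp add: leaves_def)
      then show ?thesis using small[of v] by auto
    qed
    \<comment> \<open>The inner values vanish and the total is a multiple of 3, so the values at the
      two leaves, each 1 or -1, are opposite.\<close>
    have "(\<Sum>v\<in>\<Union>\<T>. tri_sum s \<T> v) = (\<Sum>v\<in>{u, w}. tri_sum s \<T> v)"
      using fin in_V zero by (intro sum.mono_neutral_right) auto
    then have "3 dvd tri_sum s \<T> u + tri_sum s \<T> w"
      using sum_tri_sum_dvd[OF assms(1), of s] uw by simp
    then have "tri_sum s \<T> w = - tri_sum s \<T> u"
      using ends[OF assms(4)] ends[OF assms(5)] by auto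
    then have eq: "tri_sum s \<T> v = tri_sum s \<T> u * (of_bool (v = u) - of_bool (v = w))"
      if "v \<in> \<Union>\<T>" for v
      using zero that uw by auto
    show "sign_combination \<T> (\<lambda>v. of_bool (v = u) - of_bool (v = w))"
    proof (cases "tri_sum s \<T> u = 1")
      case True
      then show ?thesis unfolding sign_combination_def using s eq by (intro exI[of _ s]) simp
    next
      case False
      then have "tri_sum s \<T> u = - 1" using ends[OF assms(4)] by auto
      moreover have "signs (\<lambda>t. - s t)" using signsD[OF s] by (force simp: signs_def)
      ultimately show ?thesis
        unfolding sign_combination_def using eq by (intro exI[of _ "\<lambda>t. - s t"]) (simp add: tri_sum_uminus)
    qed
  }
qed

text \<open>For the boundary 0 the two translates differ only by sign, so they are missed
  together.\<close>

lemma sign_combination_uminus: "sign_combination \<T> (\<lambda>v. - \<beta> v) \<longleftrightarrow> sign_combination \<T> \<beta>"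
proof -
  have "sign_combination \<T> (\<lambda>v. - \<beta> v)" if "sign_combination \<T> \<beta>" for \<beta>
  proof -
    from that obtain s where s: "signs s" "\<forall>v\<in>\<Union>\<T>. [tri_sum s \<T> v = \<beta> v] (mod 3)"
      unfolding sign_combination_def by blast
    then have "signs (\<lambda>t. - s t)" using signsD[OF s(1)] by (force simp: signs_def)
    moreover have "\<forall>v\<in>\<Union>\<T>. [tri_sum (\<lambda>t. - s t) \<T> v = - \<beta> v] (mod 3)"
      unfolding tri_sum_uminus cong_minus_minus_iff by (rule s(2))
    ultimately show ?thesis unfolding sign_combination_def by blast
  qed
  from this[of \<beta>] this[of "\<lambda>v. - \<beta> v"] show ?thesis by auto
qed

theorem corollary1p10:
  fixes G :: "('v, 'e) mgraph"
  assumes "crystal G"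
  shows "(\<not> (\<exists>D f. nowhere_zero_3_flow G D f) \<longleftrightarrow> (\<forall>v \<in> mverts G. odd (vertex_degree G v))) \<and>
    (Z3_connected G \<longleftrightarrow> vertex_colorable 3 G)"
proof -
  obtain T e u w where path: "triangle_path T" and leaf: "tree_leaf T u" "tree_leaf T w" "u \<noteq> w"
    and e: "e \<notin> medges T" "mends T e = {u, w}" and G: "G = T\<lparr>medges := insert e (medges T)\<rparr>"
    using assms by (auto simp: crystal_def)
  have tree: "triangle_tree T" using path by (simp add: triangle_path_def)
  interpret T: loopfree_mgraph T by (rule triangle_tree_loopfree) fact
  interpret G: loopfree_mgraph G by (rule crystal_loopfree) fact
  obtain \<T> where \<T>: "triangulates \<T> T"
    and tree_attains: "\<And>\<beta>. Z3_boundary T \<beta> \<Longrightarrow> attains T \<beta> \<longleftrightarrow> \<not> sign_combination \<T> \<beta>"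
    using triangle_tree_attains_iff[OF tree] by blast
  have stack: "triangle_stack \<T>" and V: "mverts T = \<Union>\<T>" "mverts G = \<Union>\<T>"
    and deg: "\<And>v. v \<in> \<Union>\<T> \<Longrightarrow> int (vertex_degree T v) = 1 + tri_sum (\<lambda>_. 1) \<T> v"
    using \<T> by (auto simp: triangulates_def G)
  have "vertex_degree T v = 2 \<longleftrightarrow> tri_sum (\<lambda>_. 1) \<T> v = 1" if "v \<in> \<Union>\<T>" for v
    using deg[OF that] by linarith
  then have leaves: "tree_leaf T v \<longleftrightarrow> v \<in> leaves \<T>" for v
    unfolding tree_leaf_def leaves_def V by blast
  have uw: "u \<in> leaves \<T>" "w \<in> leaves \<T>" "u \<in> \<Union>\<T>" "w \<in> \<Union>\<T>"
    using leaf leaves by (auto simp: leaves_def)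
  let ?d = "\<lambda>v. of_bool (v = u) - of_bool (v = w) :: int"
  have sum_d: "(\<Sum>v\<in>\<Union>\<T>. ?d v) = 0"
    using sum_edge[of "\<Union>\<T>" u w "\<lambda>_. 1"] uw T.finite_mverts V by simp
  \<comment> \<open>The edge \<open>e\<close> has two directions, so \<open>\<beta>\<close> is
    missed exactly if the triangle-path misses both translates.\<close>
  have attains_G: "attains G \<beta> \<longleftrightarrow> \<not> (sign_combination \<T> (\<lambda>v. \<beta> v + ?d v) \<and> sign_combination \<T> (\<lambda>v. \<beta> v - ?d v))"
    if "3 dvd (\<Sum>v\<in>\<Union>\<T>. \<beta> v)" for \<beta>
  proof -
    have "(\<Sum>v\<in>\<Union>\<T>. \<beta> v + ?d v) = sum \<beta> (\<Union>\<T>)" "(\<Sum>v\<in>\<Union>\<T>. \<beta> v - ?d v) = sum \<beta> (\<Union>\<T>)"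
      unfolding sum.distrib[of \<beta>] sum_subtractf[of \<beta>] sum_d by simp_all
    then have "Z3_boundary T (\<lambda>v. \<beta> v + ?d v)" "Z3_boundary T (\<lambda>v. \<beta> v - ?d v)"
      using that unfolding Z3_boundary_def V cong_0_iff by simp_all
    then show ?thesis
      unfolding G attains_add_edge[OF T.finite_medges e] using tree_attains by blast
  qed

  have "card \<T> = 1 \<or> card (leaves \<T>) = 2"
    using path triangle_stack_Union(2)[OF stack] by (auto simp: triangle_path_def V leaves)
  then obtain A where A: "w \<in> A" "triangle_strip u A \<T>"
    using triangle_stack_imp_strip[OF stack] uw leaf by blast
  have "\<not> (\<exists>D f. nowhere_zero_3_flow G D f) \<longleftrightarrow> sign_combination \<T> ?d"
    unfolding G.nowhere_zero_3_flow_iff_attains_0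
    using attains_G[of "\<lambda>_. 0"] sign_combination_uminus[of \<T> ?d] by simp
  also have "\<dots> \<longleftrightarrow> (\<forall>v\<in>\<Union>\<T> - {u, w}. even (tri_sum (\<lambda>_. 1) \<T> v))"
    by (rule sign_combination_edge_iff_even[OF stack A(2,1) uw(1,2)])
  also have "\<dots> \<longleftrightarrow> (\<forall>v\<in>mverts G. odd (vertex_degree G v))"
  proof -
    have degG: "vertex_degree G v = of_bool (v \<in> {u, w}) + vertex_degree T v" for v
    proof -
      have "{x \<in> medges G. v \<in> mends G x} =
          {x \<in> {e}. v \<in> {u, w}} \<union> {x \<in> medges T. v \<in> mends T x}"
        using e by (auto simp: G)
      then show ?thesis
        using e(1) T.finite_medges
        by (auto simp: vertex_degree_def card_insert_if)
    qed
    \<comment> \<open>The extra edge raises the two leaves from degree 2 to 3; every other degree is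
      one more than the number of triangles.\<close>
    have "odd (vertex_degree G v) \<longleftrightarrow> v \<in> {u, w} \<or> even (tri_sum (\<lambda>_. 1) \<T> v)"
      if "v \<in> \<Union>\<T>" for v
    proof (cases "v \<in> {u, w}")
      case True
      then have "vertex_degree T v = 2" using leaf by (auto simp: tree_leaf_def)
      then show ?thesis using True by (simp add: degG)
    next
      case False
      have "odd (vertex_degree T v) \<longleftrightarrow> odd (int (vertex_degree T v))" by simp
      also have "\<dots> \<longleftrightarrow> even (tri_sum (\<lambda>_. 1) \<T> v)" unfolding deg[OF that] by simp
      finally show ?thesis using False by (simp add: degG)
    qed
    then show ?thesis unfolding V by blast
  qed
  finally have i: "\<not> (\<exists>D f. nowhere_zero_3_flow G D f) \<longleftrightarrow>
    (\<forall>v\<in>mverts G. odd (vertex_degree G v))" .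

  have adj: "madjacent G p q \<longleftrightarrow> madjacent T p q \<or> {p, q} = {u, w}" for p q
    using e by (auto simp: madjacent_def G)
  have colourable: "vertex_colorable 3 G \<longleftrightarrow> (\<exists>c. rainbow c \<T> \<and> c u \<noteq> c w)"
  proof -
    have "((\<forall>v\<in>mverts G. c v < 3) \<and>
        (\<forall>p\<in>mverts G. \<forall>q\<in>mverts G. madjacent G p q \<longrightarrow> c p \<noteq> c q)) \<longleftrightarrow>
      rainbow c \<T> \<and> c u \<noteq> c w" for c :: "'v \<Rightarrow> nat"
      unfolding proper_colouring_iff_rainbow[OF \<T>, symmetric] adj V
      using uw(3,4) by (auto simp: doubleton_eq_iff)
    then show ?thesis by (simp add: vertex_colorable_def)
  qed
  have "Z3_connected G \<longleftrightarrow> (\<exists>c. rainbow c \<T> \<and> c u \<noteq> c w)"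
  proof
    assume conn: "Z3_connected G"
    obtain c where c: "rainbow c \<T>" using rainbow_exists[OF stack] by blast
    \<comment> \<open>Any colouring of the triangles will do: equal colours at \<open>u\<close> and
      \<open>w\<close> would yield a missed boundary.\<close>
    have "c u \<noteq> c w"
    proof
      assume "c u = c w"
      then obtain \<beta> where \<beta>: "3 dvd (\<Sum>v\<in>\<Union>\<T>. \<beta> v)"
        "sign_combination \<T> (\<lambda>v. \<beta> v + ?d v)" "sign_combination \<T> (\<lambda>v. \<beta> v - ?d v)"
        using same_colour_imp_sign_combination_translates[OF stack c uw(3,4)] by blast
      have "attains G \<beta>"
        using conn \<beta>(1) unfolding Z3_connected_iff_attains[OF G.finite_medges]
        by (simp add: Z3_boundary_def V cong_0_iff)
      then show False using attains_G \<beta> by blast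
    qed
    with c show "\<exists>c. rainbow c \<T> \<and> c u \<noteq> c w" by blast
  next
    assume "\<exists>c. rainbow c \<T> \<and> c u \<noteq> c w"
    then obtain c where c: "rainbow c \<T>" "c u \<noteq> c w" by blast
    \<comment> \<open>A missed boundary would make both translates sign combinations and so force
      equal colours at \<open>u\<close> and \<open>w\<close>.\<close>
    have "attains G \<beta>" if "Z3_boundary G \<beta>" for \<beta>
    proof -
      have "3 dvd (\<Sum>v\<in>\<Union>\<T>. \<beta> v)" using that by (simp add: Z3_boundary_def V cong_0_iff)
      then show ?thesis
        using attains_G sign_combination_translates_imp_same_colour[OF stack c(1) uw(3,4)] c(2) by blast
    qed
    then show "Z3_connected G" by (simp add: Z3_connected_iff_attains[OF G.finite_medges])
  qed
  with i colourable show ?thesis by simp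
qed

end
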